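(* Let $f(x)=|x-\xi|^{\alpha}g(x)$ be the model function on $\Omega=[-1,1]$ described in the context, and let $f_n$ be its Chebyshev projection of degree $n$. As $n\to\infty$, the following statements hold (for each fixed $x\in\Omega$). (i) If $\xi\in(-1,1)$, then for $x\neq\xi$ $$f(x)-f_n(x) = -\frac{\mathcal{I}_1(\alpha,\xi)}{4}\left[U_{2n}(\cos(\varphi_{\xi}^{+}(x)))+U_{2n}(\cos(\varphi_{\xi}^{-}(x)))\right]n^{-\alpha-1}+O(n^{-\alpha-2}),$$ and for $x=\xi$ $$f(x)-f_n(x)=\frac{\mathcal{I}_1(\alpha,\xi)}{2\alpha}n^{-\alpha}-\mathcal{I}_1(\alpha,\xi)\frac{U_{2n}(\xi)+1}{4}n^{-\alpha-1}+O(n^{-\alpha-2}).$$ (ii) If $\xi=1$, then $$f(x)-f_n(x)=\mathcal{B}(\alpha,\xi)\begin{cases}\dfrac{1}{2\alpha}n^{-2\alpha}-\dfrac12 n^{-2\alpha-1}+O(n^{-2\alpha-2}), & x=\xi,\\[2mm] -\dfrac{U_{2n}(\cos(\varphi_{\xi}^{+}(x)))}{2}n^{-2\alpha-1}+O(n^{-2\alpha-2}), & x\neq\xi.\end{cases}$$ If $\xi=-1$, then $$f(x)-f_n(x)=\mathcal{B}(\alpha,\xi)\begin{cases}\dfrac{1}{2\alpha}n^{-2\alpha}-\dfrac12 n^{-2\alpha-1}+O(n^{-2\alpha-2}), & x=\xi,\\[2mm] -\dfrac{U_{2n}(\cos(\varphi_{\xi}^{-}(x)))}{2}n^{-2\alpha-1}+O(n^{-2\alpha-2}),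 & x\neq\xi.\end{cases}$$
   Context: Let $\Omega=[-1,1]$. The model function is $f(x)=|x-\xi|^{\alpha}g(x)$, where $\xi\in\Omega$; $\alpha>0$ is not an even integer if $\xi\in(-1,1)$ and is not an integer if $\xi=\pm1$; and $g\in C^{\infty}(\Omega)$ with $g(\xi)\neq0$. $T_k(x)=\cos(k\arccos x)$ and $U_k$ denote the Chebyshev polynomials of degree $k$ of the first and second kind, respectively. The Chebyshev coefficients of $f$ are $a_k=\frac{2}{\pi}\int_{-1}^{1}\frac{f(x)T_k(x)}{\sqrt{1-x^2}}\,dx$, and the Chebyshev projection of degree $n$ of $f$ is $f_n(x)=\frac{a_0}{2}+\sum_{k=1}^{n}a_kT_k(x)$. Notation: $\varphi_{\xi}^{\pm}(x)=\dfrac{\arccos(x)\pm\arccos(\xi)}{2}$, $$\mathcal{I}_1(\alpha,\xi)=-\frac{4(1-\xi^2)^{\alpha/2}\Gamma(\alpha+1)}{\pi}\sin\left(\frac{\alpha\pi}{2}\right)g(\xi),\qquad \mathcal{B}(\alpha,\xi)=-\frac{\sin(\alpha\pi)\Gamma(2\alpha+1)}{2^{\alpha-1}\pi}g(\xi).$$ The estimates are pointwise: the implied constants in the $O$-terms may depend on $x$ (and on $f$) but not on $n$. *)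

theory Defs
  imports "HOL-Analysis.Analysis" "HOL-Library.Landau_Symbols"
begin

(* C^infinity on a set of reals: D k is the k-th derivative of g, where derivatives are taken
   within S (hence one-sided at the endpoints when S is a compact interval). *)
definition smooth_real_on :: "real set \<Rightarrow> (real \<Rightarrow> real) \<Rightarrow> bool" where
  "smooth_real_on S g \<longleftrightarrow>
     (\<exists>D :: nat \<Rightarrow> real \<Rightarrow> real.
        (\<forall>x\<in>S. D 0 x = g x) \<and>
        (\<forall>k. \<forall>x\<in>S. (D k has_real_derivative D (Suc k) x) (at x within S)))"

(* powr gives the value 0 at x = xi, as required since alpha > 0. *)
definition model_fun :: "real \<Rightarrow> real \<Rightarrow> (real \<Rightarrow> real) \<Rightarrow> real \<Rightarrow> real" where
  "model_fun \<alpha> \<xi> g x = \<bar>x - \<xi>\<bar> powr \<alpha> * g x"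

(* Only meaningful for x in [-1,1], the domain of arccos. *)
definition cheb_T :: "nat \<Rightarrow> real \<Rightarrow> real" where
  "cheb_T k x = cos (real k * arccos x)"

fun cheb_U :: "nat \<Rightarrow> real \<Rightarrow> real" where
  "cheb_U 0 x = 1"
| "cheb_U (Suc 0) x = 2 * x"
| "cheb_U (Suc (Suc k)) x = 2 * x * cheb_U (Suc k) x - cheb_U k x"

lemma cheb_U_cos: "cheb_U k (cos t) * sin t = sin (real (Suc k) * t)"
proof (induction k "cos t" rule: cheb_U.induct)
  case 2
  show ?case using sin_double[of t] by simp
next
  case (3 k)
  have "sin (real (Suc (Suc (Suc k))) * t) + sin (real (Suc k) * t)
          = 2 * cos t * sin (real (Suc (Suc k)) * t)"
    using sin_add[of "real (Suc (Suc k)) * t" t] sin_diff[of "real (Suc (Suc k)) * t" t]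
    by (simp add: algebra_simps)
  with 3 show ?case by (simp add: algebra_simps)
qed simp

(* The integrand takes the value 0 at -1 and 1, where the denominator vanishes; this does not
   affect the integral. *)
definition cheb_coeff :: "(real \<Rightarrow> real) \<Rightarrow> nat \<Rightarrow> real" where
  "cheb_coeff f k = 2 / pi * integral {-1..1} (\<lambda>x. f x * cheb_T k x / sqrt (1 - x\<^sup>2))"

definition cheb_proj :: "(real \<Rightarrow> real) \<Rightarrow> nat \<Rightarrow> real \<Rightarrow> real" where
  "cheb_proj f n x = cheb_coeff f 0 / 2 + (\<Sum>k=1..n. cheb_coeff f k * cheb_T k x)"

definition phi_plus :: "real \<Rightarrow> real \<Rightarrow> real" where
  "phi_plus \<xi> x = (arccos x + arccos \<xi>) / 2"

definition phi_minus :: "real \<Rightarrow> real \<Rightarrow> real" where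
  "phi_minus \<xi> x = (arccos x - arccos \<xi>) / 2"

definition I1 :: "real \<Rightarrow> real \<Rightarrow> (real \<Rightarrow> real) \<Rightarrow> real" where
  "I1 \<alpha> \<xi> g = - (4 * (1 - \<xi>\<^sup>2) powr (\<alpha> / 2) * Gamma (\<alpha> + 1) / pi) * sin (\<alpha> * pi / 2) * g \<xi>"

definition Bcoef :: "real \<Rightarrow> real \<Rightarrow> (real \<Rightarrow> real) \<Rightarrow> real" where
  "Bcoef \<alpha> \<xi> g = - (sin (\<alpha> * pi) * Gamma (2 * \<alpha> + 1) / (2 powr (\<alpha> - 1) * pi)) * g \<xi>"

end

theory Submission
  imports Defs "HOL-Real_Asymp.Real_Asymp"
begin

text \<open>
  Substituting x = cos t turns f into an even periodic function F(t) and its Chebyshev coefficients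
  into the cosine coefficients of F. Near t = theta = arccos xi (and near - theta), F is a smooth
  multiple of p(t - theta)^b, where p(s) = 2 - 2 cos s = (2 sin(s/2))^2, with b = alpha/2 if xi is
  interior and b = alpha if xi is an endpoint. Repeated division by p expands the smooth
  factor in the functions p^i and p^i sin, up to a multiple of a high power of p; so F differs from
  a finite combination of translates of p^(b+i) and p^(b+i) sin by a function that is as smooth as
  we please, and whose coefficients therefore decay as fast as needed. The Fourier coefficients of
  p^b satisfy a two-term recurrence, which gives them as a quotient of Gamma functions. Hence the
  Chebyshev coefficients of f are
  A cos(k theta) k^(-s) + B sin(k theta) k^(-s-1) + O(k^(-s-2)) with s = 2 b + 1. The coefficients
  are absolutely summable, so the error is the tail of the series. Summation by parts shows that
  an oscillating tail is smaller than a non-oscillating one by a factor n, and this is what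
  separates the cases x = xi and x ~= xi.
\<close>

section \<open>Finitely differentiable functions on open sets\<close>

text \<open>Powers of p replace powers of |s| because they are periodic, so no cut-off is needed,
  and because their Fourier coefficients are known exactly. The size of the error term shapes the
  rest. Without oscillation the tail of k^(-s-1) has order n^(-s), more than the allowed
  O(n^(-s-1)). So the coefficients are needed up to O(k^(-s-2)), and a correction of order k^(-s-1)
  is tolerable only if its tail always oscillates. Parity ensures this. The coefficients of p^b have
  no term just after the leading one; the next is two orders smaller. The k^(-s-1) term therefore
  comes only from p^b sin, and enters the coefficients of f multiplied by sin(k theta). Against
  cos(k arccos x) it gives series in sin(2 k phi), with phi = phi_plus or phi_minus, which oscillate
  or vanish identically; hence B may stay unspecified. The cosine series, in contrast, stops
  oscillating when sin phi = 0, as for phi_minus at x = xi, and then has a larger tail. At an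
  endpoint phi_plus and phi_minus agree modulo pi, so the two contributions add up.\<close>

primrec ck_on :: "nat \<Rightarrow> real set \<Rightarrow> (real \<Rightarrow> real) \<Rightarrow> bool" where
  "ck_on 0 S f \<longleftrightarrow> continuous_on S f"
| "ck_on (Suc m) S f \<longleftrightarrow> (\<forall>x\<in>S. f differentiable (at x)) \<and> ck_on m S (deriv f)"

text \<open>\<open>deriv\<close> at x depends only on values near x, and S is open. This allows a
  function to be replaced by a formula that is valid only on S. Being smooth on S is expressed as
  \<open>ck_on m S f\<close> for all m.\<close>

lemma ck_on_cong:
  assumes "open S" "\<And>x. x \<in> S \<Longrightarrow> f x = g x" "ck_on m S f"
  shows "ck_on m S g"
  using assms(2,3)
proof (induction m arbitrary: f g)
  case 0
  then show ?case by (simp cong: continuous_on_cong)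
next
  case (Suc m)
  have g: "(g has_real_derivative deriv f x) (at x)" if "x \<in> S" for x
  proof -
    have "(f has_real_derivative deriv f x) (at x)"
      using Suc.prems(2) that by (simp add: DERIV_deriv_iff_real_differentiable)
    then show ?thesis
      by (rule has_field_derivative_transform_within_open[OF _ assms(1) that Suc.prems(1)])
  qed
  have "ck_on m S (deriv g)"
  proof (rule Suc.IH)
    show "deriv f x = deriv g x" if "x \<in> S" for x
      using DERIV_imp_deriv[OF g[OF that]] by simp
  qed (use Suc.prems in simp)
  moreover have "\<forall>x\<in>S. g differentiable (at x)"
    using g real_differentiable_def by blast
  ultimately show ?case by simp
qed

lemma ck_on_SucI:
  assumes "open S" "\<And>x. x \<in> S \<Longrightarrow> (f has_real_derivative f' x) (at x)" "ck_on m S f'"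
  shows "ck_on (Suc m) S f"
proof -
  have "ck_on m S (deriv f)"
    by (rule ck_on_cong[OF assms(1) _ assms(3)]) (use assms(2) DERIV_imp_deriv in metis)
  moreover have "\<forall>x\<in>S. f differentiable (at x)"
    using assms(2) real_differentiable_def by blast
  ultimately show ?thesis by simp
qed

lemma ck_on_SucD:
  assumes "ck_on (Suc m) S f" "x \<in> S"
  shows "(f has_real_derivative deriv f x) (at x)"
  using assms by (simp add: DERIV_deriv_iff_real_differentiable)

lemma ck_on_Suc_mono: "ck_on (Suc m) S f \<Longrightarrow> ck_on m S f"
proof (induction m arbitrary: f)
  case 0
  then show ?case
    by (auto intro!: continuous_at_imp_continuous_on differentiable_imp_continuous_within)
qed simp

lemma ck_on_imp_continuous_on: "ck_on m S f \<Longrightarrow> continuous_on S f"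
proof (induction m)
  case (Suc m)
  from Suc.IH[OF ck_on_Suc_mono[OF Suc.prems]] show ?case .
qed simp

lemma ck_on_subset: "ck_on m S f \<Longrightarrow> T \<subseteq> S \<Longrightarrow> ck_on m T f"
  by (induction m arbitrary: f) (auto intro: continuous_on_subset)

lemma ck_on_Un: "open S \<Longrightarrow> open T \<Longrightarrow> ck_on m S f \<Longrightarrow> ck_on m T f \<Longrightarrow> ck_on m (S \<union> T) f"
  by (induction m arbitrary: f) (auto intro: continuous_on_open_Un)

lemma ck_on_const: "ck_on m S (\<lambda>x. c)"
  by (induction m arbitrary: c) auto

lemma ck_on_add:
  assumes "open S"
  shows "ck_on m S f \<Longrightarrow> ck_on m S g \<Longrightarrow> ck_on m S (\<lambda>x. f x + g x)"
proof (induction m arbitrary: f g)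
  case 0
  then show ?case by (simp add: continuous_on_add)
next
  case (Suc m)
  show ?case
    by (rule ck_on_SucI[OF assms, of _ "\<lambda>x. deriv f x + deriv g x"])
      (use Suc in \<open>auto intro!: DERIV_add simp: DERIV_deriv_iff_real_differentiable\<close>)
qed

lemma ck_on_mult:
  assumes "open S"
  shows "ck_on m S f \<Longrightarrow> ck_on m S g \<Longrightarrow> ck_on m S (\<lambda>x. f x * g x)"
proof (induction m arbitrary: f g)
  case 0
  then show ?case by (simp add: continuous_on_mult)
next
  case (Suc m)
  show ?case
  proof (rule ck_on_SucI[OF assms])
    show "((\<lambda>x. f x * g x) has_real_derivative deriv f x * g x + f x * deriv g x) (at x)"
      if "x \<in> S" for x
      using ck_on_SucD[OF Suc.prems(1) that] ck_on_SucD[OF Suc.prems(2) that]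
      by (auto intro!: derivative_eq_intros)
    show "ck_on m S (\<lambda>x. deriv f x * g x + f x * deriv g x)"
      using Suc.prems Suc.prems[THEN ck_on_Suc_mono] by (intro ck_on_add assms Suc.IH) auto
  qed
qed

lemma ck_on_cmult: "open S \<Longrightarrow> ck_on m S f \<Longrightarrow> ck_on m S (\<lambda>x. c * f x)"
  by (rule ck_on_mult[OF _ ck_on_const])

lemma ck_on_diff:
  assumes "open S" "ck_on m S f" "ck_on m S g"
  shows "ck_on m S (\<lambda>x. f x - g x)"
  using ck_on_add[OF assms(1,2) ck_on_cmult[OF assms(1,3), of "-1"]] by simp

lemma ck_on_sum:
  assumes "open S" "\<And>i. i \<in> I \<Longrightarrow> ck_on m S (f i)"
  shows "ck_on m S (\<lambda>x. \<Sum>i\<in>I. f i x)"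
  using assms(2) by (induction I rule: infinite_finite_induct) (simp_all add: ck_on_add ck_on_const assms)

lemma ck_on_inverse:
  assumes "open S" "\<And>x. x \<in> S \<Longrightarrow> f x \<noteq> 0"
  shows "ck_on m S f \<Longrightarrow> ck_on m S (\<lambda>x. inverse (f x))"
proof (induction m)
  case 0
  then show ?case using assms by (auto intro!: continuous_on_inverse)
next
  case (Suc m)
  have f: "ck_on m S f" by (rule ck_on_Suc_mono) fact
  show ?case
  proof (rule ck_on_SucI[OF assms(1)])
    show "((\<lambda>x. inverse (f x)) has_real_derivative (- 1) * (inverse (f x) * (deriv f x * inverse (f x)))) (at x)"
      if "x \<in> S" for x
      using ck_on_SucD[OF Suc.prems(1) that] assms(2)[OF that]
      by (auto intro!: derivative_eq_intros)
    show "ck_on m S (\<lambda>x. (- 1) * (inverse (f x) * (deriv f x * inverse (f x))))"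
      using Suc.prems Suc.IH[OF f] by (intro ck_on_cmult ck_on_mult assms) auto
  qed
qed

lemma ck_on_powr:
  assumes "open S" "\<And>x. x \<in> S \<Longrightarrow> f x > 0"
  shows "ck_on m S f \<Longrightarrow> ck_on m S (\<lambda>x. f x powr a)"
proof (induction m arbitrary: a)
  case 0
  then show ?case using assms(2) by (auto intro!: continuous_intros) (metis less_irrefl)
next
  case (Suc m)
  have f: "ck_on m S f" by (rule ck_on_Suc_mono) fact
  show ?case
  proof (rule ck_on_SucI[OF assms(1)])
    show "((\<lambda>x. f x powr a) has_real_derivative a * (f x powr (a - 1) * deriv f x)) (at x)"
      if "x \<in> S" for x
      using DERIV_powr[OF ck_on_SucD[OF Suc.prems that] assms(2)[OF that] DERIV_const[of a]] assms(2)[OF that]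
      by (simp add: powr_diff field_simps)
    show "ck_on m S (\<lambda>x. a * (f x powr (a - 1) * deriv f x))"
      using Suc.prems Suc.IH[OF f] by (intro ck_on_cmult ck_on_mult assms) auto
  qed
qed

lemma ck_on_affine:
  assumes "open S"
  shows "ck_on m S f \<Longrightarrow> ck_on m {x. e * x + c \<in> S} (\<lambda>x. f (e * x + c))"
proof (induction m arbitrary: f)
  case 0
  have "continuous_on {x. e * x + c \<in> S} (\<lambda>x. e * x + c)"
    by (intro continuous_intros)
  with 0 show ?case by (auto intro: continuous_on_compose2)
next
  case (Suc m)
  have o: "open {x. e * x + c \<in> S}"
    using open_vimage[OF assms, of "\<lambda>x. e * x + c"]
    by (simp add: vimage_def continuous_intros)
  show ?case
  proof (rule ck_on_SucI[OF o])
    show "((\<lambda>x. f (e * x + c)) has_real_derivative e * deriv f (e * x + c)) (at x)"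
      if "x \<in> {x. e * x + c \<in> S}" for x
    proof -
      have "((\<lambda>x. e * x + c) has_real_derivative e) (at x)"
        by (auto intro!: derivative_eq_intros)
      from DERIV_chain2[OF ck_on_SucD[OF Suc.prems] this] that show ?thesis
        by (simp add: mult.commute)
    qed
    show "ck_on m {x. e * x + c \<in> S} (\<lambda>x. e * deriv f (e * x + c))"
      using Suc.prems by (intro ck_on_cmult[OF o] Suc.IH[of "deriv f"]) simp
  qed
qed

lemma ck_on_sin_cos: "ck_on m UNIV sin \<and> ck_on m UNIV (cos :: real \<Rightarrow> real)"
proof (induction m)
  case 0
  show ?case by (auto intro!: continuous_intros)
next
  case (Suc m)
  have "ck_on m UNIV (\<lambda>x. (- 1) * sin x)"
    by (rule ck_on_cmult[OF open_UNIV]) (use Suc in blast)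
  moreover have "(cos has_real_derivative (- 1) * sin x) (at x)" for x :: real
    using DERIV_cos[of x] by simp
  ultimately show ?case
    using ck_on_SucI[OF open_UNIV DERIV_sin, of m] ck_on_SucI[OF open_UNIV, of cos "\<lambda>x. (- 1) * sin x" m] Suc
    by blast
qed

lemma ck_on_sin: "ck_on m S sin" and ck_on_cos: "ck_on m S cos"
  using ck_on_subset[OF conjunct1[OF ck_on_sin_cos]] ck_on_subset[OF conjunct2[OF ck_on_sin_cos]] by simp_all

text \<open>At the endpoints g has only one-sided derivatives, but cos never leaves [-1,1]. The
  chain rule for derivatives within \<open>range cos\<close> thus gives two-sided derivatives in t,
  also where cos t = 1 or cos t = -1.\<close>

lemma ck_on_smooth_cos:
  assumes "smooth_real_on {-1..1} g"
  shows "ck_on m UNIV (\<lambda>t. g (cos t))"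
proof -
  obtain D where D: "\<And>x. x \<in> {-1..1} \<Longrightarrow> D 0 x = g x"
    "\<And>k x. x \<in> {-1..1} \<Longrightarrow> (D k has_real_derivative D (Suc k) x) (at x within {-1..1})"
    using assms unfolding smooth_real_on_def by metis
  have d: "((\<lambda>t. D k (cos t)) has_real_derivative (- 1) * (D (Suc k) (cos t) * sin t)) (at t)" for k t
  proof -
    have "(D k has_real_derivative D (Suc k) (cos t)) (at (cos t) within range cos)"
      by (rule DERIV_subset[OF D(2)]) auto
    from DERIV_image_chain[OF this DERIV_cos] show ?thesis
      by (simp add: mult.commute o_def)
  qed
  have "ck_on m UNIV (\<lambda>t. D k (cos t))" for k
  proof (induction m arbitrary: k)
    case 0
    show ?case
      unfolding ck_on.simps by (intro continuous_at_imp_continuous_on ballI DERIV_isCont[OF d])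
  next
    case (Suc m)
    show ?case
      by (rule ck_on_SucI[OF open_UNIV d])
        (rule ck_on_cmult[OF open_UNIV ck_on_mult[OF open_UNIV Suc ck_on_sin]])
  qed
  from this[of 0] show ?thesis
    by (rule ck_on_cong[OF open_UNIV, rotated]) (simp add: D(1))
qed

section \<open>Expansion at a singularity\<close>

text \<open>Twice the versed sine, that is |1 - e^(is)|^2. So \<open>vers s powr b\<close> is |1 -
  e^(is)|^(2b), a periodic function that behaves like |s|^(2b) at 0.\<close>

definition vers :: "real \<Rightarrow> real" where
  "vers s = 2 - 2 * cos s"

lemma vers_nonneg: "vers s \<ge> 0"
  unfolding vers_def using cos_le_one[of s] by linarith

lemma vers_minus [simp]: "vers (- s) = vers s"
  by (simp add: vers_def)

lemma vers_periodic: "vers (s + 2 * pi) = vers s"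
  by (simp add: vers_def)

lemma vers_half: "vers s = (2 * sin (s / 2))\<^sup>2"
  using cos_double_sin[of "s / 2"] by (simp add: vers_def power2_eq_square)

lemma vers_pos: "0 < \<bar>s\<bar> \<Longrightarrow> \<bar>s\<bar> < 2 * pi \<Longrightarrow> vers s > 0"
proof -
  assume s: "0 < \<bar>s\<bar>" "\<bar>s\<bar> < 2 * pi"
  have "sin (\<bar>s\<bar> / 2) > 0"
    using s by (intro sin_gt_zero) auto
  then have "sin (s / 2) \<noteq> 0"
    by (cases "s \<ge> 0") simp_all
  then show ?thesis by (simp add: vers_half)
qed

text \<open>At 0 the difference quotient is \<open>y powr (b - 1)\<close>, which tends to 0. The
  one-sided derivative is enough for composition with \<open>vers\<close>, whose values are
  nonnegative, and so \<open>vers s powr b\<close> can be differentiated at its zeros too.\<close>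

lemma has_real_derivative_powr_nonneg:
  fixes b x :: real
  assumes "b > 1" "x \<ge> 0"
  shows "((\<lambda>x. x powr b) has_real_derivative b * x powr (b - 1)) (at x within {0..})"
proof (cases "x = 0")
  case False
  then have "((\<lambda>x. x powr b) has_real_derivative b * x powr (b - 1)) (at x)"
    using assms by (intro has_real_derivative_powr) auto
  then show ?thesis by (rule has_field_derivative_at_within)
next
  case True
  have "((\<lambda>y. y powr (b - 1)) \<longlongrightarrow> 0 powr (b - 1)) (at 0 within {0..} :: real filter)"
    by (rule tendsto_powr2[OF tendsto_ident_at tendsto_const]) (use assms in \<open>auto simp: eventually_at_filter\<close>)
  moreover have "eventually (\<lambda>y. y powr (b - 1) = (y powr b - 0 powr b) / (y - 0)) (at 0 within {0..} :: real filter)"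
    unfolding eventually_at_filter
    by (rule always_eventually) (simp add: powr_diff)
  ultimately have "((\<lambda>y. (y powr b - 0 powr b) / (y - 0)) \<longlongrightarrow> 0 powr (b - 1)) (at 0 within {0..} :: real filter)"
    by (rule Lim_transform_eventually)
  then show ?thesis using True by (simp add: has_field_derivative_iff)
qed

lemma DERIV_vers_powr:
  assumes "b > 1"
  shows "((\<lambda>s. vers s powr b) has_real_derivative (2 * b) * (sin s * vers s powr (b - 1))) (at s)"
proof -
  have "(vers has_real_derivative 2 * sin s) (at s)"
    unfolding vers_def[abs_def] by (auto intro!: derivative_eq_intros)
  moreover have "((\<lambda>x. x powr b) has_real_derivative b * vers s powr (b - 1)) (at (vers s) within range vers)"
    by (rule DERIV_subset[OF has_real_derivative_powr_nonneg]) (use assms vers_nonneg in auto)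
  ultimately show ?thesis
    using DERIV_image_chain[of "\<lambda>x. x powr b" "b * vers s powr (b - 1)" vers s UNIV "2 * sin s"]
    by (simp add: o_def mult_ac)
qed

text \<open>The same formula for every exponent, away from the zeros of \<open>vers\<close>. The
  recurrence for the coefficients needs it, since b may be at most 1 there.\<close>

lemma DERIV_vers_powr':
  assumes "vers s > 0"
  shows "((\<lambda>s. vers s powr b) has_real_derivative (2 * b) * (sin s * vers s powr (b - 1))) (at s)"
proof -
  have "(vers has_real_derivative 2 * sin s) (at s)"
    unfolding vers_def[abs_def] by (auto intro!: derivative_eq_intros)
  from DERIV_chain2[OF has_real_derivative_powr[OF assms] this]
  show ?thesis by (simp add: mult_ac)
qed

lemma continuous_on_vers_powr: "b > 0 \<Longrightarrow> continuous_on S (\<lambda>s. vers s powr b)"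
  using vers_nonneg by (intro continuous_on_powr' continuous_intros) (auto simp: vers_def intro!: continuous_intros)

lemma ck_on_vers: "ck_on m S vers"
proof -
  have "ck_on m UNIV (\<lambda>s. 2 - 2 * cos s)"
    by (intro ck_on_diff ck_on_cmult ck_on_const ck_on_cos open_UNIV)
  from ck_on_subset[OF this] show ?thesis by (simp add: vers_def[abs_def])
qed

text \<open>Each derivative lowers the exponent by 1 and leaves a smooth factor \<open>sin\<close>.
  The count is crude, because the function behaves like |s|^(2b), but the expansion below can be
  carried to any order.\<close>

lemma ck_on_vers_powr: "b > real m \<Longrightarrow> ck_on m S (\<lambda>s. vers s powr b)"
proof -
  have "b > real m \<Longrightarrow> ck_on m UNIV (\<lambda>s. vers s powr b)"
  proof (induction m arbitrary: b)
    case 0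
    then show ?case by (simp add: continuous_on_vers_powr)
  next
    case (Suc m)
    show ?case
      by (rule ck_on_SucI[OF open_UNIV DERIV_vers_powr])
        (use Suc in \<open>auto intro!: ck_on_cmult[OF open_UNIV] ck_on_mult[OF open_UNIV] ck_on_sin\<close>)
  qed
  from ck_on_subset[OF this] show "b > real m \<Longrightarrow> ck_on m S (\<lambda>s. vers s powr b)"
    by simp
qed

lemma vers_powr_mult_power: "vers s powr b * vers s ^ i = vers s powr (b + real i)"
  using vers_nonneg[of s] by (cases "vers s = 0") (auto simp: powr_add powr_realpow)

text \<open>Differentiation under the integral sign; Hadamard's quotient f x / x is the average of f' over [0, x].\<close>

lemma ck_on_averaged:
  assumes "open S" "convex S" "0 \<in> S"
  shows "ck_on m S f \<Longrightarrow> ck_on m S (\<lambda>x. integral {0..1} (\<lambda>t. t ^ j * f (t * x)))"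
proof -
  have S: "t * x \<in> S" if "x \<in> S" "t \<in> {0..1}" for x t
    using convexD_alt[OF assms(2,3) that(1), of t] that(2) by auto
  have cont: "continuous_on (S \<times> cbox 0 1) (\<lambda>(x, t). t ^ i * f (t * x))" if "continuous_on S f" for f i
    unfolding case_prod_beta
    by (rule continuous_on_mult[OF continuous_on_power continuous_on_compose2[OF that]])
      (use S in \<open>simp_all add: continuous_intros image_subset_iff\<close>)
  show "ck_on m S f \<Longrightarrow> ck_on m S (\<lambda>x. integral {0..1} (\<lambda>t. t ^ j * f (t * x)))"
  \<comment> \<open>Each differentiation in x brings out a factor t; the weight \<open>t ^ j\<close>
    with arbitrary \<open>j\<close> absorbs it.\<close>
  proof (induction m arbitrary: f j)
    case 0
    then show ?case
      using integral_continuous_on_param[OF cont[of f j]] by simp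
  next
    case (Suc m)
    show ?case
    proof (rule ck_on_SucI[OF assms(1)])
      fix x assume x: "x \<in> S"
      have "((\<lambda>x. integral (cbox 0 1) (\<lambda>t. t ^ j * f (t * x))) has_real_derivative
          integral (cbox 0 1) (\<lambda>t. t ^ Suc j * deriv f (t * x))) (at x within S)"
      proof (rule leibniz_rule_field_derivative)
        fix y t :: real assume y: "y \<in> S" "t \<in> cbox 0 1"
        have "((*) t has_real_derivative t) (at y)"
          by (rule DERIV_cmult_Id)
        from DERIV_chain2[OF ck_on_SucD[OF Suc.prems S[of y t]] this] y
        have "((\<lambda>x. f (t * x)) has_real_derivative deriv f (t * y) * t) (at y)"
          by simp
        from DERIV_cmult[OF this, of "t ^ j"] have "((\<lambda>x. t ^ j * f (t * x)) has_real_derivative t ^ Suc j * deriv f (t * y)) (at y)"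
          by (simp add: ac_simps)
        then show "((\<lambda>x. t ^ j * f (t * x)) has_real_derivative t ^ Suc j * deriv f (t * y)) (at y within S)"
          by (rule has_field_derivative_at_within)
      next
        fix y :: real assume "y \<in> S"
        then have "continuous_on (cbox 0 1) (\<lambda>t. t ^ j * f (t * y))"
          by (intro continuous_on_mult continuous_on_power continuous_on_id
              continuous_on_compose2[OF ck_on_imp_continuous_on[OF Suc.prems]] continuous_on_const)
            (simp, simp add: image_subset_iff S \<open>y \<in> S\<close>)
        then show "(\<lambda>t. t ^ j * f (t * y)) integrable_on cbox 0 1"
          by (rule integrable_continuous)
      next
        show "continuous_on (S \<times> cbox 0 1) (\<lambda>(x, t). t ^ Suc j * deriv f (t * x))"
          using cont[OF ck_on_imp_continuous_on[of m S "deriv f"], of "Suc j"] Suc.prems by simp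
      qed (fact x, fact assms(2))
      then show "((\<lambda>x. integral {0..1} (\<lambda>t. t ^ j * f (t * x))) has_real_derivative
          integral {0..1} (\<lambda>t. t ^ Suc j * deriv f (t * x))) (at x)"
        unfolding at_within_open[OF x assms(1)] cbox_interval .
    next
      show "ck_on m S (\<lambda>x. integral {0..1} (\<lambda>t. t ^ Suc j * deriv f (t * x)))"
        using Suc.IH[of "deriv f" "Suc j"] Suc.prems by simp
    qed
  qed
qed

text \<open>The value of q at 0 is recorded so that the division can be iterated: if
  \<open>deriv f 0 = 0\<close>, then q vanishes at 0 and can be divided by x again.\<close>

lemma hadamard:
  assumes "open S" "convex S" "0 \<in> S" "\<And>m. ck_on m S f" "f 0 = 0"
  obtains q where "\<And>m. ck_on m S q" "\<And>x. x \<in> S \<Longrightarrow> f x = x * q x" "q 0 = deriv f 0"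
proof
  define q where "q = (\<lambda>x. integral {0..1} (\<lambda>t. t ^ 0 * deriv f (t * x)))"
  show "ck_on m S q" for m
    unfolding q_def using assms(4)[of "Suc m"]
    by (intro ck_on_averaged[OF assms(1-3), of m "deriv f" 0]) simp
  show "q 0 = deriv f 0" by (simp add: q_def)
  fix x :: real assume x: "x \<in> S"
  have S: "t * x \<in> S" if "t \<in> {0..1}" for t
    using convexD_alt[OF assms(2,3) x, of t] that by auto
  have "((\<lambda>t. deriv f (t * x) * x) has_integral f (1 * x) - f (0 * x)) {0..1}"
  proof (rule fundamental_theorem_of_calculus)
    fix t :: real assume "t \<in> {0..1}"
    have "((\<lambda>t. t * x) has_real_derivative x) (at t)"
      by (auto intro!: derivative_eq_intros)
    from DERIV_chain2[OF ck_on_SucD[OF assms(4)[of 1, unfolded One_nat_def] S] this] \<open>t \<in> {0..1}\<close>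
    have "((\<lambda>t. f (t * x)) has_real_derivative deriv f (t * x) * x) (at t)" by simp
    then show "((\<lambda>t. f (t * x)) has_vector_derivative deriv f (t * x) * x) (at t within {0..1})"
      unfolding has_real_derivative_iff_has_vector_derivative[symmetric]
      by (rule has_field_derivative_at_within)
  qed simp
  then have "((\<lambda>t. deriv f (t * x) * x) has_integral f x) {0..1}"
    by (simp add: assms(5))
  from integral_unique[OF this] have "integral {0..1} (\<lambda>t. deriv f (t * x)) * x = f x"
    by simp
  then show "f x = x * q x" by (simp add: q_def mult.commute[of x])
qed

text \<open>Two applications of Hadamard's lemma divide by s^2, and vers s = (s * r s)^2 with r smooth and nonzero on S.\<close>

lemma vers_division:
  assumes S: "open S" "convex S" "0 \<in> S" "S \<subseteq> {-2*pi<..<2*pi}" and W: "\<And>m. ck_on m S W"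
  obtains W1 where "\<And>m. ck_on m S W1"
    "\<And>s. s \<in> S \<Longrightarrow> W s = W 0 + deriv W 0 * sin s + vers s * W1 s"
proof -
  \<comment> \<open>The first-order Taylor polynomial, with \<open>sin s\<close> in place of s. Like
    s, it has value 0 and derivative 1 at 0, but it is also periodic.\<close>
  define R where "R = (\<lambda>s. W s - (W 0 + deriv W 0 * sin s))"
  have R: "ck_on m S R" for m
    unfolding R_def by (intro ck_on_diff ck_on_add ck_on_cmult ck_on_const ck_on_sin S W)
  have "(R has_real_derivative 0) (at 0)"
    unfolding R_def using ck_on_SucD[OF W[of 1, unfolded One_nat_def] S(3)]
    by (auto intro!: derivative_eq_intros)
  then have R0: "deriv R 0 = 0" by (rule DERIV_imp_deriv)
  obtain q where q: "\<And>m. ck_on m S q" "\<And>x. x \<in> S \<Longrightarrow> R x = x * q x" "q 0 = deriv R 0"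
    by (rule hadamard[OF S(1-3) R]) (auto simp: R_def)
  obtain q2 where q2: "\<And>m. ck_on m S q2" "\<And>x. x \<in> S \<Longrightarrow> q x = x * q2 x"
    using hadamard[OF S(1-3) q(1)] q(3) R0 by metis
  have h: "ck_on m S (\<lambda>s. 2 * sin (s / 2))" for m
  proof -
    have "ck_on m UNIV (\<lambda>s. 2 * sin (1 / 2 * s + 0))"
      using ck_on_affine[OF open_UNIV ck_on_sin, of m "1/2" 0] by (intro ck_on_cmult) auto
    from ck_on_subset[OF this] show ?thesis by simp
  qed
  obtain r where r: "\<And>m. ck_on m S r" "\<And>x. x \<in> S \<Longrightarrow> 2 * sin (x / 2) = x * r x"
     "r 0 = deriv (\<lambda>s. 2 * sin (s / 2)) 0"
    by (rule hadamard[OF S(1-3) h]) auto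
  have "((\<lambda>s. 2 * sin (s / 2)) has_real_derivative 1) (at 0)"
    by (auto intro!: derivative_eq_intros)
  then have r0: "r 0 = 1" using r(3) DERIV_imp_deriv by simp
  \<comment> \<open>In S the only zero of \<open>vers\<close> is 0, and there r equals the
    derivative of 2 sin(s/2), which is 1.\<close>
  have rnz: "r s \<noteq> 0" if "s \<in> S" for s
  proof (cases "s = 0")
    case False
    then have "vers s > 0" using S(4) that by (intro vers_pos) (auto simp: abs_less_iff)
    then show ?thesis using r(2)[OF that] by (auto simp: vers_half)
  qed (simp add: r0)
  define W1 where "W1 = (\<lambda>s. q2 s * (inverse (r s) * inverse (r s)))"
  show thesis
  proof
    show "ck_on m S W1" for m
      unfolding W1_def by (intro ck_on_mult ck_on_inverse q2 r S rnz)
    fix s assume s: "s \<in> S"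
    have "vers s * W1 s = s * (s * q2 s)"
      using rnz[OF s] unfolding vers_half r(2)[OF s] W1_def by (simp add: field_simps power2_eq_square)
    also have "\<dots> = R s" using q(2) q2(2) s by simp
    finally show "W s = W 0 + deriv W 0 * sin s + vers s * W1 s" by (simp add: R_def)
  qed
qed

text \<open>The remainder W' is again smooth, so it can be divided in turn. Only the first two
  coefficients are identified: all later ones contribute only to error terms.\<close>

lemma vers_expansion:
  assumes S: "open S" "convex S" "0 \<in> S" "S \<subseteq> {-2*pi<..<2*pi}" and W: "\<And>m. ck_on m S W"
  shows "\<exists>a c W'. a 0 = W 0 \<and> c 0 = deriv W 0 \<and> (\<forall>m. ck_on m S W') \<and>
     (\<forall>s\<in>S. W s = (\<Sum>i<Suc N. vers s ^ i * (a i + c i * sin s)) + vers s ^ Suc N * W' s)"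
proof (induction N)
  case 0
  obtain W1 where "\<And>m. ck_on m S W1"
    "\<And>s. s \<in> S \<Longrightarrow> W s = W 0 + deriv W 0 * sin s + vers s * W1 s"
    using vers_division[OF assms] by blast
  then show ?case
    by (intro exI[of _ "\<lambda>_. W 0"] exI[of _ "\<lambda>_. deriv W 0"] exI[of _ W1]) auto
next
  case (Suc N)
  then obtain a c W' where IH: "a 0 = W 0" "c 0 = deriv W 0" "\<And>m. ck_on m S W'"
     "\<And>s. s \<in> S \<Longrightarrow> W s = (\<Sum>i<Suc N. vers s ^ i * (a i + c i * sin s)) + vers s ^ Suc N * W' s"
    by blast
  obtain W1 where W1: "\<And>m. ck_on m S W1"
    "\<And>s. s \<in> S \<Longrightarrow> W' s = W' 0 + deriv W' 0 * sin s + vers s * W1 s"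
    using vers_division[OF S IH(3)] by blast
  define a' where "a' = a(Suc N := W' 0)"
  define c' where "c' = c(Suc N := deriv W' 0)"
  have "W s = (\<Sum>i<Suc (Suc N). vers s ^ i * (a' i + c' i * sin s)) + vers s ^ Suc (Suc N) * W1 s"
    if "s \<in> S" for s
  proof -
    have eq: "(\<Sum>i<Suc N. vers s ^ i * (a' i + c' i * sin s)) = (\<Sum>i<Suc N. vers s ^ i * (a i + c i * sin s))"
      by (rule sum.cong) (simp_all add: a'_def c'_def)
    show ?thesis
      unfolding sum.lessThan_Suc[of _ "Suc N"] eq IH(4)[OF that]
      by (simp only: W1(2)[OF that] a'_def c'_def fun_upd_same power_Suc ring_distribs mult_ac add_ac)
  qed
  moreover have "a' 0 = W 0" "c' 0 = deriv W 0" using IH by (simp_all add: a'_def c'_def)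
  ultimately show ?case
    by (intro exI[of _ a'] exI[of _ c'] exI[of _ W1] conjI allI ballI W1(1))
qed

definition sing_part :: "real \<Rightarrow> nat \<Rightarrow> (nat \<Rightarrow> real) \<Rightarrow> (nat \<Rightarrow> real) \<Rightarrow> real \<Rightarrow> real" where
  "sing_part b N a c s = (\<Sum>i<Suc N. vers s powr (b + real i) * (a i + c i * sin s))"

text \<open>With N = m the remainder carries the factor vers^(b+m+1), which is m times continuously
  differentiable because its exponent exceeds m.\<close>

lemma sing_part_exists:
  assumes S: "open S" "convex S" "0 \<in> S" "S \<subseteq> {-2*pi<..<2*pi}" and W: "\<And>m. ck_on m S W"
    and b: "b > 0"
  obtains N a c where "a 0 = W 0" "c 0 = deriv W 0"
     "ck_on m S (\<lambda>s. vers s powr b * W s - sing_part b N a c s)"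
proof -
  obtain a c W' where W': "a 0 = W 0" "c 0 = deriv W 0" "\<And>m. ck_on m S W'"
     "\<And>s. s \<in> S \<Longrightarrow> W s = (\<Sum>i<Suc m. vers s ^ i * (a i + c i * sin s)) + vers s ^ Suc m * W' s"
    using vers_expansion[OF assms(1-5), of m] by blast
  have "ck_on m S (\<lambda>s. vers s powr (b + real (Suc m)) * W' s)"
    by (intro ck_on_mult ck_on_vers_powr W'(3) S) (use b in auto)
  moreover have "vers s powr (b + real (Suc m)) * W' s = vers s powr b * W s - sing_part b m a c s"
    if "s \<in> S" for s
  proof -
    have "sing_part b m a c s = vers s powr b * (\<Sum>i<Suc m. vers s ^ i * (a i + c i * sin s))"
      unfolding sing_part_def sum_distrib_left vers_powr_mult_power[symmetric] by (simp only: mult.assoc)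
    then show ?thesis
      unfolding W'(4)[OF that] vers_powr_mult_power[symmetric] by (simp only: ring_distribs mult.assoc add_diff_cancel_left')
  qed
  ultimately have "ck_on m S (\<lambda>s. vers s powr b * W s - sing_part b m a c s)"
    by (rule ck_on_cong[OF S(1), rotated])
  then show thesis by (rule that[of a c m, OF W'(1,2)])
qed

section \<open>Fourier coefficients\<close>

lemma deriv_periodic:
  assumes "\<And>x. f (x + p) = f x"
  shows "deriv f (x + p) = deriv f x"
proof -
  have "DERIV f (x + p) :> D \<longleftrightarrow> DERIV f x :> D" for D
    using DERIV_shift[of f D x p] assms by simp
  then show ?thesis by (simp add: deriv_def)
qed

text \<open>In the first formula the boundary terms vanish because sin(k pi) = 0; in the second they
  cancel because f takes the same value at pi and -pi.\<close>

lemma fourier_ibp: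
  fixes f :: "real \<Rightarrow> real"
  assumes f: "\<And>x. x \<in> {-pi..pi} \<Longrightarrow> (f has_real_derivative f' x) (at x)"
    and f': "continuous_on {-pi..pi} f'" and per: "f pi = f (- pi)" and k: "k > 0"
  shows "integral {-pi..pi} (\<lambda>x. f x * cos (real k * x)) =
           - (integral {-pi..pi} (\<lambda>x. f' x * sin (real k * x)) / k)"
    and "integral {-pi..pi} (\<lambda>x. f x * sin (real k * x)) =
           integral {-pi..pi} (\<lambda>x. f' x * cos (real k * x)) / k"
proof -
  have cf: "continuous_on {-pi..pi} f"
    using f by (intro continuous_at_imp_continuous_on ballI DERIV_isCont)
  have int: "(\<lambda>x. u x * cos (real k * x)) integrable_on {-pi..pi}"
    "(\<lambda>x. u x * sin (real k * x)) integrable_on {-pi..pi}" if "continuous_on {-pi..pi} u" for u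
    by (intro integrable_continuous_real continuous_on_mult that continuous_intros)+
  have "((\<lambda>x. f' x * sin (real k * x) + k * (f x * cos (real k * x))) has_integral
      f pi * sin (real k * pi) - f (- pi) * sin (real k * (- pi))) {-pi..pi}"
  proof (rule fundamental_theorem_of_calculus)
    fix x assume x: "x \<in> {-pi..pi}"
    have "((\<lambda>x. f x * sin (real k * x)) has_real_derivative f' x * sin (real k * x) + k * (f x * cos (real k * x))) (at x)"
      using f[OF x] by (auto intro!: derivative_eq_intros)
    then show "((\<lambda>x. f x * sin (real k * x)) has_vector_derivative f' x * sin (real k * x) + k * (f x * cos (real k * x))) (at x within {-pi..pi})"
      unfolding has_real_derivative_iff_has_vector_derivative[symmetric] by (rule has_field_derivative_at_within)
  qed simp
  from integral_unique[OF this]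
  have "integral {-pi..pi} (\<lambda>x. f' x * sin (real k * x)) + k * integral {-pi..pi} (\<lambda>x. f x * cos (real k * x)) = 0"
    using int[OF cf] int[OF f'] by (simp add: integral_add integrable_on_mult_right)
  then show "integral {-pi..pi} (\<lambda>x. f x * cos (real k * x)) =
           - (integral {-pi..pi} (\<lambda>x. f' x * sin (real k * x)) / k)"
    using k by (simp add: field_simps)
  have "((\<lambda>x. f' x * cos (real k * x) - k * (f x * sin (real k * x))) has_integral
      f pi * cos (real k * pi) - f (- pi) * cos (real k * (- pi))) {-pi..pi}"
  proof (rule fundamental_theorem_of_calculus)
    fix x assume x: "x \<in> {-pi..pi}"
    have "((\<lambda>x. f x * cos (real k * x)) has_real_derivative f' x * cos (real k * x) - k * (f x * sin (real k * x))) (at x)"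
      using f[OF x] by (auto intro!: derivative_eq_intros)
    then show "((\<lambda>x. f x * cos (real k * x)) has_vector_derivative f' x * cos (real k * x) - k * (f x * sin (real k * x))) (at x within {-pi..pi})"
      unfolding has_real_derivative_iff_has_vector_derivative[symmetric] by (rule has_field_derivative_at_within)
  qed simp
  from integral_unique[OF this]
  have "integral {-pi..pi} (\<lambda>x. f' x * cos (real k * x)) - k * integral {-pi..pi} (\<lambda>x. f x * sin (real k * x)) = 0"
    using int[OF cf] int[OF f'] per by (simp add: integral_diff integrable_on_mult_right)
  then show "integral {-pi..pi} (\<lambda>x. f x * sin (real k * x)) =
           integral {-pi..pi} (\<lambda>x. f' x * cos (real k * x)) / k"
    using k by (simp add: field_simps)
qed

lemma integral_abs_bound:
  fixes f g :: "real \<Rightarrow> real"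
  assumes "continuous_on {-pi..pi} f" "continuous_on {-pi..pi} g" "\<And>x. \<bar>g x\<bar> \<le> 1"
  shows "\<bar>integral {-pi..pi} (\<lambda>x. f x * g x)\<bar> \<le> integral {-pi..pi} (\<lambda>x. \<bar>f x\<bar>)"
  unfolding real_norm_def[symmetric]
proof (rule integral_norm_bound_integral)
  show "(\<lambda>x. f x * g x) integrable_on {-pi..pi}" "(\<lambda>x. norm (f x)) integrable_on {-pi..pi}"
    by (intro integrable_continuous_real continuous_intros assms)+
  show "norm (f x * g x) \<le> norm (f x)" for x
    using mult_left_mono[OF assms(3)[of x], of "\<bar>f x\<bar>"] by (simp add: abs_mult)
qed

text \<open>Integration by parts exchanges sine and cosine and gains a factor 1/k, so both bounds go
  through the induction together. The constant is the integral of the absolute value of the m-th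
  derivative and does not grow on the way.\<close>

lemma fourier_decay:
  assumes S: "{-pi..pi} \<subseteq> S" and per: "\<And>x. f (x + 2 * pi) = f x" and f: "ck_on m S f"
  shows "\<exists>C. \<forall>k>0. \<bar>integral {-pi..pi} (\<lambda>x. f x * cos (real k * x))\<bar> \<le> C / real k ^ m \<and>
                   \<bar>integral {-pi..pi} (\<lambda>x. f x * sin (real k * x))\<bar> \<le> C / real k ^ m"
  using per f
proof (induction m arbitrary: f)
  case 0
  have "continuous_on {-pi..pi} f" using 0 S continuous_on_subset by auto
  then show ?case
    using integral_abs_bound[of f "\<lambda>x. cos (real _ * x)"] integral_abs_bound[of f "\<lambda>x. sin (real _ * x)"]
    by (intro exI[of _ "integral {-pi..pi} (\<lambda>x. \<bar>f x\<bar>)"]) (simp add: continuous_intros)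
next
  case (Suc m)
  have f': "ck_on m S (deriv f)" using Suc.prems by simp
  obtain C where C: "\<And>k. k > 0 \<Longrightarrow> \<bar>integral {-pi..pi} (\<lambda>x. deriv f x * cos (real k * x))\<bar> \<le> C / real k ^ m"
      "\<And>k. k > 0 \<Longrightarrow> \<bar>integral {-pi..pi} (\<lambda>x. deriv f x * sin (real k * x))\<bar> \<le> C / real k ^ m"
    using Suc.IH[of "deriv f", OF deriv_periodic[of f "2 * pi", OF Suc.prems(1)] f'] by auto
  have d: "(f has_real_derivative deriv f x) (at x)" if "x \<in> {-pi..pi}" for x
    using ck_on_SucD[OF Suc.prems(2)] that S by auto
  have c: "continuous_on {-pi..pi} (deriv f)"
    using continuous_on_subset[OF ck_on_imp_continuous_on[OF f'] S] .
  have p: "f pi = f (- pi)" using Suc.prems(1)[of "- pi"] by simp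
  show ?case
  proof (intro exI[of _ C] allI impI)
    fix k :: nat assume k: "k > 0"
    have ibp: "integral {-pi..pi} (\<lambda>x. f x * cos (real k * x)) = - (integral {-pi..pi} (\<lambda>x. deriv f x * sin (real k * x)) / k)"
      "integral {-pi..pi} (\<lambda>x. f x * sin (real k * x)) = integral {-pi..pi} (\<lambda>x. deriv f x * cos (real k * x)) / k"
      by (rule fourier_ibp[OF d c p k]; assumption)+
    show "\<bar>integral {-pi..pi} (\<lambda>x. f x * cos (real k * x))\<bar> \<le> C / real k ^ Suc m \<and>
          \<bar>integral {-pi..pi} (\<lambda>x. f x * sin (real k * x))\<bar> \<le> C / real k ^ Suc m"
      unfolding ibp using divide_right_mono[OF C(1)[OF k], of "real k"] divide_right_mono[OF C(2)[OF k], of "real k"]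
      by (simp add: mult.commute[of "real k"])
  qed
qed

lemma fourier_decay_bigo:
  assumes S: "{-pi..pi} \<subseteq> S" and per: "\<And>x. f (x + 2 * pi) = f x" and f: "ck_on m S f" and e: "e \<le> real m"
  shows "(\<lambda>k. integral {-pi..pi} (\<lambda>x. f x * cos (real k * x))) \<in> O(\<lambda>k. real k powr (- e))"
    and "(\<lambda>k. integral {-pi..pi} (\<lambda>x. f x * sin (real k * x))) \<in> O(\<lambda>k. real k powr (- e))"
proof -
  obtain C where C: "\<And>k. k > 0 \<Longrightarrow> \<bar>integral {-pi..pi} (\<lambda>x. f x * cos (real k * x))\<bar> \<le> C / real k ^ m"
      "\<And>k. k > 0 \<Longrightarrow> \<bar>integral {-pi..pi} (\<lambda>x. f x * sin (real k * x))\<bar> \<le> C / real k ^ m"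
    using fourier_decay[OF S per f] by auto
  have le: "C / real k ^ m \<le> \<bar>C\<bar> * real k powr (- e)" if "k > 0" for k
  proof -
    have "real k powr (- real m) \<le> real k powr (- e)"
      using that e by (intro powr_mono) auto
    moreover have "C / real k ^ m \<le> \<bar>C\<bar> * real k powr (- real m)"
      using that by (simp add: powr_minus powr_realpow divide_inverse mult_right_mono)
    ultimately show ?thesis by (meson abs_ge_zero mult_left_mono order_trans)
  qed
  show "(\<lambda>k. integral {-pi..pi} (\<lambda>x. f x * cos (real k * x))) \<in> O(\<lambda>k. real k powr (- e))"
    by (rule bigoI[of _ "\<bar>C\<bar>"], rule eventually_mono[OF eventually_gt_at_top[of 0]])
      (use order_trans[OF C(1) le] in simp)
  show "(\<lambda>k. integral {-pi..pi} (\<lambda>x. f x * sin (real k * x))) \<in> O(\<lambda>k. real k powr (- e))"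
    by (rule bigoI[of _ "\<bar>C\<bar>"], rule eventually_mono[OF eventually_gt_at_top[of 0]])
      (use order_trans[OF C(2) le] in simp)
qed

section \<open>Symmetric integrals and the substitution x = cos t\<close>

lemma integral_symmetric:
  fixes f :: "real \<Rightarrow> real"
  assumes "continuous_on {-a..a} f" "a \<ge> 0"
  shows "integral {-a..a} f = integral {0..a} (\<lambda>x. f x + f (- x))"
proof -
  have i: "f integrable_on {-a..a}" using assms by (intro integrable_continuous_real)
  have "integral {-a..a} f = integral {-a..0} f + integral {0..a} f"
    using Henstock_Kurzweil_Integration.integral_combine[OF _ _ i, of 0] assms(2) by simp
  also have "integral {-a..0} f = integral {0..a} (\<lambda>x. f (- x))"
    using Henstock_Kurzweil_Integration.integral_reflect_real[of a 0 "\<lambda>x. f (- x)"] by simp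
  also have "integral {0..a} (\<lambda>x. f (- x)) + integral {0..a} f = integral {0..a} (\<lambda>x. f x + f (- x))"
  proof (subst integral_add)
    show "f integrable_on {0..a}"
      using i by (rule integrable_on_subinterval) (use assms in auto)
    have "continuous_on {0..a} (\<lambda>x. f (- x))"
      by (rule continuous_on_compose2[OF assms(1)]) (auto intro!: continuous_intros)
    then show "(\<lambda>x. f (- x)) integrable_on {0..a}" by (rule integrable_continuous_real)
  qed simp
  finally show ?thesis .
qed

lemma integral_even:
  fixes f :: "real \<Rightarrow> real"
  assumes "continuous_on {-a..a} f" "a \<ge> 0" "\<And>x. f (- x) = f x"
  shows "integral {-a..a} f = 2 * integral {0..a} f"
  unfolding integral_symmetric[OF assms(1,2)] by (simp add: assms(3))

lemma integral_odd:
  fixes f :: "real \<Rightarrow> real"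
  assumes "continuous_on {-a..a} f" "a \<ge> 0" "\<And>x. f (- x) = - f x"
  shows "integral {-a..a} f = 0"
  unfolding integral_symmetric[OF assms(1,2)] by (simp add: assms(3))

text \<open>The weight is unbounded at -1 and 1. The antiderivative -\<Phi>(arccos x) is
  nevertheless continuous on [-1,1] and differentiable inside, which is enough for the fundamental
  theorem of the gauge integral.\<close>

lemma integral_arccos_substitution:
  assumes "continuous_on {0..pi} \<phi>"
  shows "((\<lambda>x. \<phi> (arccos x) / sqrt (1 - x\<^sup>2)) has_integral integral {0..pi} \<phi>) {-1..1}"
proof -
  define \<Phi> where "\<Phi> = (\<lambda>t. integral {0..t} \<phi>)"
  have \<Phi>: "(\<Phi> has_real_derivative \<phi> t) (at t)" if "t \<in> {0<..<pi}" for t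
  proof -
    have "(\<Phi> has_real_derivative \<phi> t) (at t within {0..pi})"
      unfolding \<Phi>_def using assms that by (intro integral_has_real_derivative) auto
    moreover have "at t within {0..pi} = at t"
      using that by (intro at_within_interior) auto
    ultimately show ?thesis by simp
  qed
  have c: "continuous_on {0..pi} \<Phi>"
    unfolding \<Phi>_def using assms by (intro indefinite_integral_continuous_1 integrable_continuous_real)
  have "((\<lambda>x. \<phi> (arccos x) / sqrt (1 - x\<^sup>2)) has_integral - \<Phi> (arccos 1) - - \<Phi> (arccos (- 1))) {-1..1}"
  proof (rule fundamental_theorem_of_calculus_interior)
    show "continuous_on {-1..1} (\<lambda>x. - \<Phi> (arccos x))"
      by (intro continuous_on_minus continuous_on_compose2[OF c] continuous_on_arccos')
        (auto simp: arccos_lbound arccos_ubound)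
    fix x :: real assume x: "x \<in> {-1<..<1}"
    have "(arccos has_real_derivative inverse (- sqrt (1 - x\<^sup>2))) (at x)"
      using x by (intro DERIV_arccos) auto
    moreover have "arccos x \<in> {0<..<pi}"
      using x arccos_lt_bounded[of x] by auto
    ultimately have "((\<lambda>x. \<Phi> (arccos x)) has_real_derivative \<phi> (arccos x) * inverse (- sqrt (1 - x\<^sup>2))) (at x)"
      by (intro DERIV_chain2[OF \<Phi>])
    from DERIV_minus[OF this]
    show "((\<lambda>x. - \<Phi> (arccos x)) has_vector_derivative \<phi> (arccos x) / sqrt (1 - x\<^sup>2)) (at x)"
      unfolding has_real_derivative_iff_has_vector_derivative[symmetric] by (simp add: divide_inverse)
  qed simp
  moreover have "- \<Phi> (arccos 1) - - \<Phi> (arccos (- 1)) = integral {0..pi} \<phi>"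
    by (simp add: \<Phi>_def)
  ultimately show ?thesis by simp
qed

section \<open>Fourier coefficients of powers of \<open>vers\<close>\<close>

definition vers_coeff :: "real \<Rightarrow> nat \<Rightarrow> real" where
  "vers_coeff b k = integral {-pi..pi} (\<lambda>s. vers s powr b * cos (real k * s))"

lemma vers_coeff_Suc:
  assumes "b > 0"
  shows "(real k + 1 + b) * vers_coeff b (Suc k) = (real k - b) * vers_coeff b k"
proof -
  \<comment> \<open>The factor multiplying vers^b is chosen such that F' is vers^b times a combination of only two cosines.\<close>
  define F where "F = (\<lambda>s. vers s powr b * (sin (real (Suc k) * s) - sin (real k * s)))"
  define F' where "F' = (\<lambda>s. (real k + 1 + b) * (vers s powr b * cos (real (Suc k) * s)) - (real k - b) * (vers s powr b * cos (real k * s)))"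
  have "(F' has_integral F pi - F (- pi)) {-pi..pi}"
  \<comment> \<open>The point 0 is exempted, since F need not be differentiable there for small b;
    continuity suffices.\<close>
  proof (rule fundamental_theorem_of_calculus_interior_strong[of "{0}"])
    show "continuous_on {-pi..pi} F"
      unfolding F_def by (intro continuous_intros continuous_on_vers_powr assms)
    fix s assume s: "s \<in> {-pi<..<pi} - {0}"
    have v: "vers s > 0" by (rule vers_pos) (use s in auto)
    have p: "vers s powr b = vers s powr (b - 1) * vers s"
      using v by (simp add: powr_diff)
    have sq: "(sin s)\<^sup>2 = 1 - (cos s)\<^sup>2" by (simp add: sin_squared_eq)
    have exp: "sin (real (Suc k) * s) = sin (real k * s) * cos s + cos (real k * s) * sin s"
      "cos (real (Suc k) * s) = cos (real k * s) * cos s - sin (real k * s) * sin s"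
      using sin_add[of "real k * s" s] cos_add[of "real k * s" s] by (simp_all add: algebra_simps)
    \<comment> \<open>Differentiating vers^b costs one factor \<open>vers s\<close>. The difference
      of sines contains a factor sin(s/2), and \<open>sin s\<close> contains another; together they
      restore it.\<close>
    have key: "2 * sin s * (sin (real (Suc k) * s) - sin (real k * s)) = vers s * (cos (real (Suc k) * s) + cos (real k * s))"
      unfolding exp vers_def using sq by algebra
    have "(F has_real_derivative (2 * b) * (sin s * vers s powr (b - 1)) * (sin (real (Suc k) * s) - sin (real k * s))
        + vers s powr b * (real (Suc k) * cos (real (Suc k) * s) - real k * cos (real k * s))) (at s)"
    proof -
      have "((\<lambda>s. sin (real (Suc k) * s) - sin (real k * s)) has_real_derivative
          real (Suc k) * cos (real (Suc k) * s) - real k * cos (real k * s)) (at s)"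
        by (auto intro!: derivative_eq_intros)
      from DERIV_mult[OF DERIV_vers_powr'[OF v, of b] this] show ?thesis
        unfolding F_def by (simp only: mult_ac)
    qed
    also have "(2 * b) * (sin s * vers s powr (b - 1)) * (sin (real (Suc k) * s) - sin (real k * s))
       = b * vers s powr (b - 1) * (2 * sin s * (sin (real (Suc k) * s) - sin (real k * s)))"
      by (simp only: mult_ac)
    also have "\<dots> = vers s powr b * b * (cos (real (Suc k) * s) + cos (real k * s))"
      unfolding key p by (simp only: mult_ac)
    also have "vers s powr b * b * (cos (real (Suc k) * s) + cos (real k * s))
        + vers s powr b * (real (Suc k) * cos (real (Suc k) * s) - real k * cos (real k * s)) = F' s"
      unfolding F'_def by (simp add: algebra_simps)
    finally show "(F has_vector_derivative F' s) (at s)"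
      unfolding has_real_derivative_iff_has_vector_derivative[symmetric] .
  qed auto
  moreover have "F pi = 0" "F (- pi) = 0" by (simp_all add: F_def del: of_nat_Suc)
  ultimately have "integral {-pi..pi} F' = 0" by (simp add: integral_unique)
  moreover have "integral {-pi..pi} F' = (real k + 1 + b) * vers_coeff b (Suc k) - (real k - b) * vers_coeff b k"
    unfolding F'_def vers_coeff_def
    by (subst integral_diff, (intro integrable_continuous_real continuous_intros continuous_on_vers_powr assms)+) simp
  ultimately show ?thesis by simp
qed

text \<open>The substitutions x = cos s and x = 1 - 2t lead to the Beta integral B(b + 1/2, 1/2),
  and Legendre's duplication formula removes Gamma(b + 1/2). For natural b the value is 2 pi times
  the central binomial coefficient of 2b over b.\<close>

lemma vers_coeff_0:
  assumes b: "b > 0"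
  shows "vers_coeff b 0 = 2 * pi * Gamma (2 * b + 1) / (Gamma (b + 1))\<^sup>2"
proof -
  define I where "I = integral {0..pi} (\<lambda>s. vers s powr b)"
  have "vers_coeff b 0 = 2 * I"
    unfolding vers_coeff_def I_def by (subst integral_even) (auto intro!: continuous_on_vers_powr b)
  have "((\<lambda>x. vers (arccos x) powr b / sqrt (1 - x\<^sup>2)) has_integral I) {-1..1}"
    unfolding I_def by (intro integral_arccos_substitution continuous_on_vers_powr b)
  then have "((\<lambda>x. (2 - 2 * x) powr b / sqrt (1 - x\<^sup>2)) has_integral I) (cbox (- 1) 1)"
    unfolding cbox_interval by (rule has_integral_eq[rotated]) (simp add: vers_def cos_arccos)
  \<comment> \<open>x = 1 - 2t turns 2 - 2x into 4t and 1 - x^2 into 4t(1 - t); the factor 1/2 comes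
    from dx.\<close>
  note * = has_integral_affinity[OF this, of "- 2" 1]
  have "((\<lambda>t. (2 - 2 * (1 - 2 * t)) powr b / sqrt (1 - (1 - 2 * t)\<^sup>2)) has_integral I / 2) {0..1}"
  proof -
    have "(\<lambda>x. 1 / 2 - x / 2) ` {- 1..1} = {0..1::real}"
      using image_affinity_atLeastAtMost[of "- 1 / 2" "1 / 2" "- 1" "1::real"] by (simp add: algebra_simps)
    with * show ?thesis by simp
  qed
  then have "((\<lambda>t. (4 * t) powr b / sqrt (4 * t * (1 - t))) has_integral I / 2) {0..1}"
    by (rule has_integral_eq[rotated]) (simp add: power2_eq_square algebra_simps)
  then have "((\<lambda>t. 4 powr b / 2 * (t powr ((b + 1/2) - 1) * (1 - t) powr (1/2 - 1))) has_integral I / 2) {0..1}"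
  proof (rule has_integral_eq[rotated])
    fix t :: real assume t: "t \<in> {0..1}"
    have "sqrt (4 * t * (1 - t)) = 2 * t powr (1/2) * (1 - t) powr (1/2)"
      using t by (simp add: real_sqrt_mult powr_half_sqrt)
    moreover have "t powr b / t powr (1/2) = t powr (b - 1/2)" by (simp add: powr_diff)
    moreover have "1 / (1 - t) powr (1/2) = (1 - t) powr (- (1/2))" by (simp add: powr_minus_divide)
    moreover have "(b + 1/2) - 1 = b - 1/2" "1/2 - 1 = - (1/2 :: real)" by simp_all
    moreover have "(4 * t) powr b = 4 powr b * t powr b" using t by (simp add: powr_mult)
    ultimately show "(4 * t) powr b / sqrt (4 * t * (1 - t)) = 4 powr b / 2 * (t powr ((b + 1/2) - 1) * (1 - t) powr (1/2 - 1))"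
      by (metis (no_types, opaque_lifting) mult.assoc mult.right_neutral times_divide_times_eq)
  qed
  moreover have "((\<lambda>t. 4 powr b / 2 * (t powr ((b + 1/2) - 1) * (1 - t) powr (1/2 - 1))) has_integral 4 powr b / 2 * Beta (b + 1/2) (1/2)) {0..1}"
    by (intro has_integral_mult_right has_integral_Beta_real) (use b in auto)
  ultimately have "I / 2 = 4 powr b / 2 * Beta (b + 1/2) (1/2)"
    by (rule has_integral_unique)
  then have "I = 4 powr b * Beta (b + 1/2) (1/2)" by simp
  also have "Beta (b + 1/2) (1/2) = Gamma (b + 1/2) * sqrt pi / Gamma (b + 1)"
    by (simp add: Beta_def Gamma_one_half_real add.commute)
  also have "Gamma (b + 1/2) = exp (- (2 * b) * ln 2) * sqrt pi * Gamma (2 * b + 1) / Gamma (b + 1)"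
  proof -
    have "complex_of_real (b + 1/2) \<notin> \<int>\<^sub>\<le>\<^sub>0" "complex_of_real (b + 1/2) + 1/2 \<notin> \<int>\<^sub>\<le>\<^sub>0"
      using b by (auto elim!: nonpos_Ints_cases simp: complex_eq_iff)
    from Gamma_legendre_duplication[OF this]
    have "complex_of_real (Gamma (b + 1/2) * Gamma (b + 1)) =
        complex_of_real (exp (- (2 * b) * ln 2) * sqrt pi * Gamma (2 * b + 1))"
      by (simp add: Gamma_complex_of_real[symmetric] exp_of_real[symmetric] algebra_simps)
    then have "Gamma (b + 1/2) * Gamma (b + 1) = exp (- (2 * b) * ln 2) * sqrt pi * Gamma (2 * b + 1)"
      by (simp only: of_real_eq_iff)
    moreover have "Gamma (b + 1) > 0" using b by (intro Gamma_real_pos) auto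
    ultimately show ?thesis by (simp add: field_simps)
  qed
  also have "exp (- (2 * b) * ln 2) = 1 / 4 powr b"
  proof -
    have "ln 4 = 2 * ln (2::real)" using ln_realpow[of 2 2] by simp
    then show ?thesis by (simp add: powr_def exp_minus field_simps)
  qed
  finally have "I = pi * Gamma (2 * b + 1) / (Gamma (b + 1))\<^sup>2"
    by (simp add: power2_eq_square)
  with \<open>vers_coeff b 0 = 2 * I\<close> show ?thesis by simp
qed

section \<open>Asymptotics of the coefficients\<close>

text \<open>The differences of h n = n^(-p) are of the exact order n^(-p-1), so they dominate those
  of A up to a constant K. Then K h - A and K h + A are eventually decreasing with limit 0, hence
  nonnegative.\<close>

lemma telescoping_bigo:
  fixes A :: "nat \<Rightarrow> real"
  assumes lim: "A \<longlonglongrightarrow> 0" and p: "p > 0"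
    and diff: "(\<lambda>n. A n - A (Suc n)) \<in> O(\<lambda>n. real n powr (- p - 1))"
  shows "A \<in> O(\<lambda>n. real n powr (- p))"
proof -
  define h where "h = (\<lambda>n. real n powr (- p))"
  have "(\<lambda>n. real n powr (- p - 1)) \<in> O(\<lambda>n. h n - h (Suc n))"
    unfolding h_def of_nat_Suc using p by real_asymp
  from landau_o.big.trans[OF diff this]
  obtain K where K: "K > 0" "eventually (\<lambda>n. norm (A n - A (Suc n)) \<le> K * norm (h n - h (Suc n))) at_top"
    by (elim landau_o.bigE)
  have "eventually (\<lambda>n. \<bar>A n - A (Suc n)\<bar> \<le> K * (h n - h (Suc n))) at_top"
    using K(2) eventually_gt_at_top[of 0]
  proof eventually_elim
    case (elim n)
    have "h (Suc n) \<le> h n" unfolding h_def using elim p by (intro powr_mono2') auto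
    with elim show ?case by simp
  qed
  then obtain N where N: "\<And>n. n \<ge> N \<Longrightarrow> \<bar>A n - A (Suc n)\<bar> \<le> K * (h n - h (Suc n))"
    by (auto simp: eventually_at_top_linorder)
  have hl: "h \<longlonglongrightarrow> 0" unfolding h_def using p by real_asymp
  have bound: "c * A n \<le> K * h n" if n: "n \<ge> N" and c: "\<bar>c\<bar> = 1" for n and c :: real
  proof -
    \<comment> \<open>The sign c, which is 1 or -1, treats the bounds for A and for -A at
      once.\<close>
    define B where "B = (\<lambda>i. K * h (i + n) - c * A (i + n))"
    have "decseq B"
    proof (rule decseq_SucI)
      fix i
      have "c * (A (i + n) - A (Suc (i + n))) \<le> K * (h (i + n) - h (Suc (i + n)))"
        using N[of "i + n"] n c by (cases "c \<ge> 0") (auto simp: abs_le_iff abs_if split: if_splits)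
      then show "B (Suc i) \<le> B i" by (simp add: B_def algebra_simps)
    qed
    moreover have "B \<longlonglongrightarrow> K * 0 - c * 0"
      unfolding B_def by (intro tendsto_intros LIMSEQ_ignore_initial_segment lim hl)
    ultimately have "B 0 \<ge> 0" using decseq_ge[of B 0 0] by simp
    then show ?thesis by (simp add: B_def)
  qed
  show ?thesis
  proof (rule bigoI[of _ K])
    show "eventually (\<lambda>n. norm (A n) \<le> K * norm (real n powr (- p))) at_top"
      using eventually_ge_at_top[of N]
    proof eventually_elim
      case (elim n)
      from bound[OF this, of 1] bound[OF this, of "- 1"] show ?case
        by (simp add: h_def abs_le_iff)
    qed
  qed
qed

lemma vers_coeff_pochhammer:
  assumes "b > 0"
  shows "vers_coeff b k = vers_coeff b 0 * pochhammer (- b) k / pochhammer (b + 1) k"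
proof (induction k)
  case (Suc k)
  have "vers_coeff b (Suc k) = (real k - b) * vers_coeff b k / (real k + 1 + b)"
    using vers_coeff_Suc[OF assms, of k] assms by (simp add: field_simps)
  moreover have "pochhammer (b + 1) k > 0" using assms by (intro pochhammer_pos) auto
  ultimately show ?case using assms by (simp add: Suc pochhammer_Suc field_simps)
qed simp

text \<open>The constant in \<open>vers_coeff b k\<close> ~ \<open>vers_const b\<close> * k^(-2b-1).
  It is 0 for natural b, when vers^b is a trigonometric polynomial.\<close>

definition vers_const :: "real \<Rightarrow> real" where
  "vers_const b = - 2 * sin (pi * b) * Gamma (2 * b + 1)"

text \<open>The quotient of Pochhammer symbols, times a power of n, is a quotient of two Gauss
  products for 1/Gamma. The reciprocal \<open>rGamma\<close> is used because Gamma(-b) has a pole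
  when b is natural. By the reflection formula the limit contains (Gamma(b+1))^2, which cancels
  against \<open>vers_coeff b 0\<close>.\<close>

lemma vers_coeff_LIMSEQ:
  assumes b: "b > 0"
  shows "(\<lambda>k. vers_coeff b k * real k powr (2 * b + 1)) \<longlonglongrightarrow> vers_const b"
proof -
  have nz: "rGamma (b + 1) \<noteq> 0"
    using b by (simp add: rGamma_eq_zero_iff) (auto elim!: nonpos_Ints_cases)
  have "(\<lambda>n. vers_coeff b 0 * (rGamma_series (- b) n / rGamma_series (b + 1) n)) \<longlonglongrightarrow>
     vers_coeff b 0 * (rGamma (- b) / rGamma (b + 1))"
    by (intro tendsto_intros nz)
  moreover have "eventually (\<lambda>n. vers_coeff b 0 * (rGamma_series (- b) n / rGamma_series (b + 1) n) =
       vers_coeff b (Suc n) * real n powr (2 * b + 1)) at_top"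
    using eventually_gt_at_top[of 0]
  proof eventually_elim
    case (elim n)
    have "rGamma_series (- b) n / rGamma_series (b + 1) n =
       pochhammer (- b) (Suc n) / pochhammer (b + 1) (Suc n) * (exp ((b + 1) * ln (real n)) / exp (- b * ln (real n)))"
      by (simp add: rGamma_series_def)
    also have "exp ((b + 1) * ln (real n)) / exp (- b * ln (real n)) = real n powr (2 * b + 1)"
      using elim by (simp add: powr_def exp_diff[symmetric] algebra_simps)
    finally show ?case by (simp add: vers_coeff_pochhammer[OF b, of "Suc n"])
  qed
  ultimately have "(\<lambda>n. vers_coeff b (Suc n) * real n powr (2 * b + 1)) \<longlonglongrightarrow>
     vers_coeff b 0 * (rGamma (- b) / rGamma (b + 1))"
    by (rule Lim_transform_eventually)
  \<comment> \<open>\<open>rGamma_series\<close> pairs index \<open>Suc n\<close> with powers of n;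
    this factor corrects the shift.\<close>
  moreover have "(\<lambda>n. (real (Suc n) / real n) powr (2 * b + 1)) \<longlonglongrightarrow> 1"
    unfolding of_nat_Suc by real_asymp
  ultimately have "(\<lambda>n. vers_coeff b (Suc n) * real n powr (2 * b + 1) * (real (Suc n) / real n) powr (2 * b + 1)) \<longlonglongrightarrow>
     vers_coeff b 0 * (rGamma (- b) / rGamma (b + 1)) * 1"
    by (rule tendsto_mult)
  moreover have "eventually (\<lambda>n. vers_coeff b (Suc n) * real n powr (2 * b + 1) * (real (Suc n) / real n) powr (2 * b + 1)
      = vers_coeff b (Suc n) * real (Suc n) powr (2 * b + 1)) at_top"
    using eventually_gt_at_top[of 0] by eventually_elim (simp add: powr_divide)
  ultimately have "(\<lambda>n. vers_coeff b (Suc n) * real (Suc n) powr (2 * b + 1)) \<longlonglongrightarrow>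
     vers_coeff b 0 * (rGamma (- b) / rGamma (b + 1)) * 1"
    by (rule Lim_transform_eventually)
  then have "(\<lambda>n. vers_coeff b n * real n powr (2 * b + 1)) \<longlonglongrightarrow>
     vers_coeff b 0 * (rGamma (- b) / rGamma (b + 1)) * 1"
    by (rule LIMSEQ_imp_Suc)
  moreover have "vers_coeff b 0 * (rGamma (- b) / rGamma (b + 1)) * 1 = vers_const b"
  proof -
    have "complex_of_real (rGamma (- b) * rGamma (1 + b)) = complex_of_real (- sin (pi * b) / pi)"
      using rGamma_reflection_complex[of "- complex_of_real b"]
      by (simp add: rGamma_complex_of_real[symmetric] sin_of_real[symmetric])
    then have *: "rGamma (- b) * rGamma (1 + b) = - sin (pi * b) / pi"
      by (simp only: of_real_eq_iff)
    have "rGamma (- b) / rGamma (b + 1) = - sin (pi * b) / pi * (Gamma (b + 1))\<^sup>2"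
      using nz unfolding *[symmetric] Gamma_def by (simp add: field_simps power2_eq_square)
    moreover have "Gamma (b + 1) > 0" using b by (intro Gamma_real_pos) auto
    ultimately show ?thesis
      unfolding vers_coeff_0[OF b] vers_const_def by simp
  qed
  ultimately show ?thesis by simp
qed

text \<open>The rescaled coefficients r converge, and the recurrence shows that r k - r (k+1) =
  O(k^(-3)); telescoping then gives r k - \<open>vers_const b\<close> = O(k^(-2)). The error is thus
  two orders below the leading term, not just one.\<close>

lemma vers_coeff_asymp:
  assumes b: "b > 0"
  shows "(\<lambda>k. vers_coeff b k - vers_const b * real k powr (- 2 * b - 1)) \<in> O(\<lambda>k. real k powr (- 2 * b - 3))"
proof -
  define r where "r = (\<lambda>k. vers_coeff b k * real k powr (2 * b + 1))"
  have r: "r \<longlonglongrightarrow> vers_const b" unfolding r_def by (rule vers_coeff_LIMSEQ[OF b])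
  then have bdd: "r \<in> O(\<lambda>_. 1)" by (intro bigoI_tendsto[of _ _ "vers_const b"]) auto
  \<comment> \<open>1 - r (k+1) / r k, when r k is not 0. Its terms of order 1/k and 1/k^2
    cancel.\<close>
  define q where "q = (\<lambda>k::nat. 1 - (real k - b) / (real k + 1 + b) * ((real k + 1) / real k) powr (2 * b + 1))"
  have q: "q \<in> O(\<lambda>k. real k powr (- 3))"
    unfolding q_def using b by (real_asymp simp: algebra_simps)
  have ev: "eventually (\<lambda>k. r k * q k = (r k - vers_const b) - (r (Suc k) - vers_const b)) at_top"
    using eventually_gt_at_top[of 0]
  proof eventually_elim
    case (elim k)
    have "vers_coeff b (Suc k) = (real k - b) * vers_coeff b k / (real k + 1 + b)"
      using vers_coeff_Suc[OF b, of k] b by (simp add: field_simps)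
    then have "r (Suc k) = r k * ((real k - b) / (real k + 1 + b) * ((real k + 1) / real k) powr (2 * b + 1))"
      using elim by (simp add: r_def powr_divide add.commute[of 1])
    then show ?case by (simp add: q_def algebra_simps)
  qed
  have "(\<lambda>k. r k * q k) \<in> O(\<lambda>k. 1 * real k powr (- 3))"
    by (rule landau_o.big.mult[OF bdd q])
  then have "(\<lambda>k. (r k - vers_const b) - (r (Suc k) - vers_const b)) \<in> O(\<lambda>k. real k powr (- 3))"
    unfolding landau_o.big.in_cong[OF ev] by simp
  then have "(\<lambda>k. r k - vers_const b) \<in> O(\<lambda>k. real k powr (- 2))"
    using telescoping_bigo[of "\<lambda>k. r k - vers_const b" 2] LIM_zero[OF r] by simp
  then have "(\<lambda>k. (r k - vers_const b) * real k powr (- 2 * b - 1)) \<in> O(\<lambda>k. real k powr (- 2) * real k powr (- 2 * b - 1))"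
    by (rule landau_o.big.mult) simp
  moreover have ev2: "eventually (\<lambda>k. (r k - vers_const b) * real k powr (- 2 * b - 1) = vers_coeff b k - vers_const b * real k powr (- 2 * b - 1)) at_top"
    using eventually_gt_at_top[of 0]
    by eventually_elim (simp add: r_def algebra_simps powr_add[symmetric])
  moreover have "real k powr (- 2) * real k powr (- 2 * b - 1) = real k powr (- 2 * b - 3)" for k
    by (subst powr_add[symmetric]) (rule arg_cong, simp)
  ultimately show ?thesis
    unfolding landau_o.big.in_cong[OF ev2] by simp
qed

lemma powr_bigo_mono:
  assumes "a \<le> b"
  shows "(\<lambda>k. real k powr a) \<in> O(\<lambda>k. real k powr b)"
  using eventually_gt_at_top[of "0::nat"]
  by (intro bigoI[of _ 1], eventually_elim) (use assms in \<open>auto intro!: powr_mono\<close>)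

lemma bigo_cmult: "f \<in> O[F](g) \<Longrightarrow> (\<lambda>x. c * f x :: real) \<in> O[F](g)"
  by simp

lemma vers_coeff_bigo:
  assumes "b > 0"
  shows "vers_coeff b \<in> O(\<lambda>k. real k powr (- 2 * b - 1))"
proof -
  have "(\<lambda>k. vers_coeff b k - vers_const b * real k powr (- 2 * b - 1)) \<in> O(\<lambda>k. real k powr (- 2 * b - 1))"
    by (rule landau_o.big.trans[OF vers_coeff_asymp[OF assms] powr_bigo_mono]) simp
  from sum_in_bigo(1)[OF this, of "\<lambda>k. vers_const b * real k powr (- 2 * b - 1)"] show ?thesis by simp
qed

definition vers_sin_coeff :: "real \<Rightarrow> nat \<Rightarrow> real" where
  "vers_sin_coeff b k = integral {-pi..pi} (\<lambda>s. vers s powr b * sin s * sin (real k * s))"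

text \<open>Up to the factor 2(b + 1), vers^b sin is the derivative of vers^(b+1), so integration by
  parts reduces its sine coefficients to known cosine coefficients.\<close>

lemma vers_sin_coeff_eq:
  assumes b: "b > 0" and k: "k > 0"
  shows "vers_sin_coeff b k = - 1 / (2 * (b + 1)) * (real k * vers_coeff (b + 1) k)"
proof -
  have "vers_coeff (b + 1) k = - (integral {-pi..pi} (\<lambda>s. 2 * (b + 1) * (sin s * vers s powr (b + 1 - 1)) * sin (real k * s)) / real k)"
    unfolding vers_coeff_def
  proof (rule fourier_ibp(1))
    show "((\<lambda>s. vers s powr (b + 1)) has_real_derivative 2 * (b + 1) * (sin x * vers x powr (b + 1 - 1))) (at x)" for x
      by (rule DERIV_vers_powr) (use b in simp)
    show "continuous_on {- pi..pi} (\<lambda>s. 2 * (b + 1) * (sin s * vers s powr (b + 1 - 1)))"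
      by (intro continuous_intros continuous_on_vers_powr) (use b in simp)
  qed (use k in simp_all)
  also have "(\<lambda>s. 2 * (b + 1) * (sin s * vers s powr (b + 1 - 1)) * sin (real k * s)) =
      (\<lambda>s. 2 * (b + 1) * (vers s powr b * sin s * sin (real k * s)))"
    by (simp add: mult_ac)
  also have "integral {-pi..pi} \<dots> = 2 * (b + 1) * vers_sin_coeff b k"
    unfolding vers_sin_coeff_def by (rule integral_mult_right)
  finally show ?thesis using b k by (simp add: field_simps)
qed

lemma vers_sin_coeff_asymp:
  assumes b: "b > 0"
  shows "(\<lambda>k. vers_sin_coeff b k - (- vers_const (b + 1) / (2 * (b + 1))) * real k powr (- 2 * b - 2))
    \<in> O(\<lambda>k. real k powr (- 2 * b - 3))"
proof -
  have "(\<lambda>k. real k * (vers_coeff (b + 1) k - vers_const (b + 1) * real k powr (- 2 * (b + 1) - 1)))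
      \<in> O(\<lambda>k. real k powr 1 * real k powr (- 2 * (b + 1) - 3))"
    by (rule landau_o.big.mult[OF _ vers_coeff_asymp]) (use b in \<open>simp_all add: bigoI[of _ 1]\<close>)
  also have "(\<lambda>k. real k powr 1 * real k powr (- 2 * (b + 1) - 3)) \<in> O(\<lambda>k. real k powr (- 2 * b - 3))"
    unfolding powr_add[symmetric] by (rule powr_bigo_mono) simp
  finally have "(\<lambda>k. - 1 / (2 * (b + 1)) * (real k * (vers_coeff (b + 1) k - vers_const (b + 1) * real k powr (- 2 * (b + 1) - 1))))
      \<in> O(\<lambda>k. real k powr (- 2 * b - 3))"
    by (rule bigo_cmult)
  moreover have ev: "eventually (\<lambda>k. - 1 / (2 * (b + 1)) * (real k * (vers_coeff (b + 1) k - vers_const (b + 1) * real k powr (- 2 * (b + 1) - 1)))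
      = vers_sin_coeff b k - (- vers_const (b + 1) / (2 * (b + 1))) * real k powr (- 2 * b - 2)) at_top"
    using eventually_gt_at_top[of 0]
  proof eventually_elim
    case (elim k)
    have "real k * real k powr (- 2 * (b + 1) - 1) = real k powr (1 + (- 2 * (b + 1) - 1))"
      unfolding powr_add using elim by simp
    also have "1 + (- 2 * (b + 1) - 1) = - 2 * b - 2" by simp
    finally have "real k powr (- 2 * b - 2) = real k * real k powr (- 2 * (b + 1) - 1)" ..
    then show ?case
      unfolding vers_sin_coeff_eq[OF b elim] by (simp add: right_diff_distrib)
  qed
  ultimately show ?thesis
    unfolding landau_o.big.in_cong[OF ev] by simp
qed

lemma vers_sin_coeff_bigo:
  assumes "b > 0"
  shows "vers_sin_coeff b \<in> O(\<lambda>k. real k powr (- 2 * b - 2))"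
proof -
  have "(\<lambda>k. vers_sin_coeff b k - (- vers_const (b + 1) / (2 * (b + 1))) * real k powr (- 2 * b - 2)) \<in> O(\<lambda>k. real k powr (- 2 * b - 2))"
    by (rule landau_o.big.trans[OF vers_sin_coeff_asymp[OF assms] powr_bigo_mono]) simp
  from sum_in_bigo(1)[OF this bigo_cmult[OF landau_o.big_refl, of "- vers_const (b + 1) / (2 * (b + 1))"]] show ?thesis
    by simp
qed

section \<open>Coefficients of the singular parts\<close>

lemma continuous_on_sing_part: "b > 0 \<Longrightarrow> continuous_on S (sing_part b N a c)"
  unfolding sing_part_def[abs_def] by (intro continuous_intros continuous_on_vers_powr) auto

lemma sing_part_periodic: "sing_part b N a c (s + 2 * pi) = sing_part b N a c s"
  unfolding sing_part_def vers_periodic by simp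

text \<open>By parity the cosine sees only the even terms, with coefficients a, and the sine only
  the odd ones, with coefficients c.\<close>

lemma sing_part_fourier:
  assumes b: "b > 0"
  shows "integral {-pi..pi} (\<lambda>s. sing_part b N a c s * cos (real k * s)) = (\<Sum>i<Suc N. a i * vers_coeff (b + real i) k)"
    and "integral {-pi..pi} (\<lambda>s. sing_part b N a c s * sin (real k * s)) = (\<Sum>i<Suc N. c i * vers_sin_coeff (b + real i) k)"
proof -
  have c1: "continuous_on {-pi..pi} (\<lambda>s. vers s powr (b + real i))" for i
    by (rule continuous_on_vers_powr) (use b in auto)
  have o1: "integral {-pi..pi} (\<lambda>s. vers s powr (b + real i) * sin s * cos (real k * s)) = 0" for i
    by (rule integral_odd) (auto intro!: continuous_intros c1)
  have o2: "integral {-pi..pi} (\<lambda>s. vers s powr (b + real i) * sin (real k * s)) = 0" for i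
    by (rule integral_odd) (auto intro!: continuous_intros c1)
  have e1: "(\<lambda>s. sing_part b N a c s * cos (real k * s)) =
     (\<lambda>s. \<Sum>i<Suc N. a i * (vers s powr (b + real i) * cos (real k * s)) + c i * (vers s powr (b + real i) * sin s * cos (real k * s)))"
    unfolding sing_part_def sum_distrib_right by (intro ext sum.cong refl) (simp add: algebra_simps)
  have e2: "(\<lambda>s. sing_part b N a c s * sin (real k * s)) =
     (\<lambda>s. \<Sum>i<Suc N. a i * (vers s powr (b + real i) * sin (real k * s)) + c i * (vers s powr (b + real i) * sin s * sin (real k * s)))"
    unfolding sing_part_def sum_distrib_right by (intro ext sum.cong refl) (simp add: algebra_simps)
  have int: "(\<lambda>s. x * (vers s powr (b + real i) * u s) + y * (vers s powr (b + real i) * v s * w s)) integrable_on {-pi..pi}"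
    if "continuous_on {-pi..pi} u" "continuous_on {-pi..pi} v" "continuous_on {-pi..pi} w" for x y u v w i
    by (intro integrable_continuous_real continuous_on_add continuous_on_mult continuous_on_const c1 that)
  have int2: "integral {-pi..pi} (\<lambda>s. x * (vers s powr (b + real i) * u s) + y * (vers s powr (b + real i) * v s * w s))
     = x * integral {-pi..pi} (\<lambda>s. vers s powr (b + real i) * u s) + y * integral {-pi..pi} (\<lambda>s. vers s powr (b + real i) * v s * w s)"
    if "continuous_on {-pi..pi} u" "continuous_on {-pi..pi} v" "continuous_on {-pi..pi} w" for x y u v w i
    by (subst integral_add, (intro integrable_continuous_real continuous_on_mult continuous_on_const c1 that)+) simp
  have cc: "continuous_on {-pi..pi} (\<lambda>s. cos (real k * s))" "continuous_on {-pi..pi} (\<lambda>s. sin (real k * s))" "continuous_on {-pi..pi} sin"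
    by (intro continuous_intros)+
  show "integral {-pi..pi} (\<lambda>s. sing_part b N a c s * cos (real k * s)) = (\<Sum>i<Suc N. a i * vers_coeff (b + real i) k)"
    unfolding e1 vers_coeff_def
    by (subst integral_sum, simp, rule int[OF cc(1) cc(3) cc(1)]) (simp only: int2[OF cc(1) cc(3) cc(1)] o1, simp)
  show "integral {-pi..pi} (\<lambda>s. sing_part b N a c s * sin (real k * s)) = (\<Sum>i<Suc N. c i * vers_sin_coeff (b + real i) k)"
    unfolding e2 vers_sin_coeff_def
    by (subst integral_sum, simp, rule int[OF cc(2) cc(3) cc(2)]) (simp only: int2[OF cc(2) cc(3) cc(2)] o2, simp)
qed

text \<open>Raising the exponent of \<open>vers\<close> by one gains two powers of k. So the terms
  with i \<ge> 1 are O(k^(-2b-3)) for the cosine and O(k^(-2b-4)) for the sine, and only i = 0 is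
  visible.\<close>

lemma sing_part_fourier_asymp:
  assumes b: "b > 0"
  shows "(\<lambda>k. integral {-pi..pi} (\<lambda>s. sing_part b N a c s * cos (real k * s)) - a 0 * vers_const b * real k powr (- 2 * b - 1))
           \<in> O(\<lambda>k. real k powr (- 2 * b - 3))"
    and "(\<lambda>k. integral {-pi..pi} (\<lambda>s. sing_part b N a c s * sin (real k * s)) - c 0 * (- vers_const (b + 1) / (2 * (b + 1))) * real k powr (- 2 * b - 2))
           \<in> O(\<lambda>k. real k powr (- 2 * b - 3))"
proof -
  have "(\<lambda>k. \<Sum>i<N. a (Suc i) * vers_coeff (b + real (Suc i)) k) \<in> O(\<lambda>k. real k powr (- 2 * b - 3))"
  proof (rule big_sum_in_bigo)
    fix i
    have "vers_coeff (b + real (Suc i)) \<in> O(\<lambda>k. real k powr (- 2 * b - 3))"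
      by (rule landau_o.big.trans[OF vers_coeff_bigo powr_bigo_mono]) (use b in auto)
    then show "(\<lambda>k. a (Suc i) * vers_coeff (b + real (Suc i)) k) \<in> O(\<lambda>k. real k powr (- 2 * b - 3))"
      by (rule bigo_cmult)
  qed
  moreover have "(\<lambda>k. a 0 * (vers_coeff b k - vers_const b * real k powr (- 2 * b - 1))) \<in> O(\<lambda>k. real k powr (- 2 * b - 3))"
    by (rule bigo_cmult[OF vers_coeff_asymp[OF b]])
  ultimately have "(\<lambda>k. a 0 * (vers_coeff b k - vers_const b * real k powr (- 2 * b - 1)) + (\<Sum>i<N. a (Suc i) * vers_coeff (b + real (Suc i)) k)) \<in> O(\<lambda>k. real k powr (- 2 * b - 3))"
    by (rule sum_in_bigo(1)[rotated])
  then show "(\<lambda>k. integral {-pi..pi} (\<lambda>s. sing_part b N a c s * cos (real k * s)) - a 0 * vers_const b * real k powr (- 2 * b - 1))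
           \<in> O(\<lambda>k. real k powr (- 2 * b - 3))"
    unfolding sing_part_fourier[OF b] sum.lessThan_Suc_shift by (simp add: algebra_simps)
  have "(\<lambda>k. \<Sum>i<N. c (Suc i) * vers_sin_coeff (b + real (Suc i)) k) \<in> O(\<lambda>k. real k powr (- 2 * b - 3))"
  proof (rule big_sum_in_bigo)
    fix i
    have "vers_sin_coeff (b + real (Suc i)) \<in> O(\<lambda>k. real k powr (- 2 * b - 3))"
      by (rule landau_o.big.trans[OF vers_sin_coeff_bigo powr_bigo_mono]) (use b in auto)
    then show "(\<lambda>k. c (Suc i) * vers_sin_coeff (b + real (Suc i)) k) \<in> O(\<lambda>k. real k powr (- 2 * b - 3))"
      by (rule bigo_cmult)
  qed
  moreover have "(\<lambda>k. c 0 * (vers_sin_coeff b k - (- vers_const (b + 1) / (2 * (b + 1))) * real k powr (- 2 * b - 2))) \<in> O(\<lambda>k. real k powr (- 2 * b - 3))"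
    by (rule bigo_cmult[OF vers_sin_coeff_asymp[OF b]])
  ultimately have "(\<lambda>k. c 0 * (vers_sin_coeff b k - (- vers_const (b + 1) / (2 * (b + 1))) * real k powr (- 2 * b - 2)) + (\<Sum>i<N. c (Suc i) * vers_sin_coeff (b + real (Suc i)) k)) \<in> O(\<lambda>k. real k powr (- 2 * b - 3))"
    by (rule sum_in_bigo(1)[rotated])
  then show "(\<lambda>k. integral {-pi..pi} (\<lambda>s. sing_part b N a c s * sin (real k * s)) - c 0 * (- vers_const (b + 1) / (2 * (b + 1))) * real k powr (- 2 * b - 2))
           \<in> O(\<lambda>k. real k powr (- 2 * b - 3))"
    unfolding sing_part_fourier[OF b] sum.lessThan_Suc_shift right_diff_distrib by (simp add: mult.assoc add_diff_eq diff_add_eq add_ac)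
qed

section \<open>Translated singularities on the circle\<close>

lemma integral_periodic_shift:
  fixes f :: "real \<Rightarrow> real"
  assumes f: "continuous_on UNIV f" and per: "\<And>x. f (x + 2 * pi) = f x" and c: "0 \<le> c" "c \<le> 2 * pi"
  shows "integral {-pi..pi} (\<lambda>t. f (t - c)) = integral {-pi..pi} f"
proof -
  have i: "f integrable_on {a..b}" for a b
    using f by (intro integrable_continuous_real) (auto intro: continuous_on_subset)
  have "integral {-pi..pi} (\<lambda>t. f (t - c)) = integral {-pi - c..pi - c} f"
    using integral_shift_Icc_real[of "-pi" pi f "- c"] by (simp add: o_def)
  also have "\<dots> = integral {-pi - c..-pi} f + integral {-pi..pi - c} f"
    by (rule Henstock_Kurzweil_Integration.integral_combine[symmetric]) (use c i in auto)
  also have "integral {-pi - c..-pi} f = integral {-pi - c..-pi} (\<lambda>x. f (x + 2 * pi))"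
    by (simp add: per)
  also have "\<dots> = integral {pi - c..pi} f"
    using integral_shift_Icc_real[of "-pi - c" "-pi" f "2 * pi"] by (simp add: o_def algebra_simps)
  also have "integral {pi - c..pi} f + integral {-pi..pi - c} f = integral {-pi..pi} f"
    by (subst add.commute, rule Henstock_Kurzweil_Integration.integral_combine) (use c i in auto)
  finally show ?thesis .
qed

text \<open>Translation mixes the two kinds of coefficients by the addition theorem. This is why
  sine coefficients of the singular part matter although only cosine coefficients of F are
  wanted.\<close>

lemma fourier_cos_shift:
  fixes f :: "real \<Rightarrow> real"
  assumes f: "continuous_on UNIV f" and per: "\<And>x. f (x + 2 * pi) = f x" and c: "0 \<le> c" "c \<le> 2 * pi"
  shows "integral {-pi..pi} (\<lambda>t. f (t - c) * cos (real k * t)) =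
     cos (real k * c) * integral {-pi..pi} (\<lambda>s. f s * cos (real k * s))
     - sin (real k * c) * integral {-pi..pi} (\<lambda>s. f s * sin (real k * s))"
proof -
  have int: "(\<lambda>s. x * (f s * cos (real k * s))) integrable_on {-pi..pi}" "(\<lambda>s. x * (f s * sin (real k * s))) integrable_on {-pi..pi}" for x
    by (intro integrable_continuous_real continuous_intros continuous_on_subset[OF f]; simp)+
  have p: "f (x + 2 * pi) * cos (real k * (x + 2 * pi + c)) = f x * cos (real k * (x + c))" for x
  proof -
    have "real k * (x + 2 * pi + c) = real k * (x + c) + 2 * real k * pi" by (simp add: algebra_simps)
    then have "cos (real k * (x + 2 * pi + c)) = cos (real k * (x + c) + 2 * real k * pi)" by simp
    also have "\<dots> = cos (real k * (x + c))"
      unfolding cos_add cos_2npi sin_2npi by simp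
    finally show ?thesis by (simp add: per)
  qed
  have "continuous_on UNIV (\<lambda>s. f s * cos (real k * (s + c)))"
    by (intro continuous_intros f)
  from integral_periodic_shift[OF this p c]
  have "integral {-pi..pi} (\<lambda>t. f (t - c) * cos (real k * t)) = integral {-pi..pi} (\<lambda>s. f s * cos (real k * (s + c)))"
    by simp
  also have "(\<lambda>s. f s * cos (real k * (s + c))) = (\<lambda>s. cos (real k * c) * (f s * cos (real k * s)) - sin (real k * c) * (f s * sin (real k * s)))"
    by (simp add: cos_add algebra_simps)
  finally show ?thesis by (simp add: integral_diff[OF int])
qed

text \<open>For the endpoints: there \<theta> and -\<theta> are the same point of the circle, so
  there is one singularity, and the factor W is smooth everywhere.\<close>

lemma fourier_vers_mult_asymp:
  assumes b: "b > 0" and W: "\<And>m. ck_on m UNIV W" and per: "\<And>s. W (s + 2 * pi) = W s"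
  obtains B where
    "(\<lambda>k. integral {-pi..pi} (\<lambda>s. vers s powr b * W s * cos (real k * s)) - W 0 * vers_const b * real k powr (- 2 * b - 1))
        \<in> O(\<lambda>k. real k powr (- 2 * b - 3))"
    "(\<lambda>k. integral {-pi..pi} (\<lambda>s. vers s powr b * W s * sin (real k * s)) - B * real k powr (- 2 * b - 2))
        \<in> O(\<lambda>k. real k powr (- 2 * b - 3))"
proof -
  \<comment> \<open>m derivatives of the regular remainder make its coefficients O(k^(-m)), hence
    O(k^(-2b-3)).\<close>
  define m where "m = nat \<lceil>2 * b + 3\<rceil>"
  have m: "2 * b + 3 \<le> real m" unfolding m_def by linarith
  have S: "open {- 2 * pi<..<2 * pi}" "convex {- 2 * pi<..<2 * pi}" "0 \<in> {- 2 * pi<..<2 * pi}" "{- 2 * pi<..<2 * pi} \<subseteq> {-2*pi<..<2*pi}"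
    by auto
  obtain N a c where T: "a 0 = W 0" "c 0 = deriv W 0"
     "ck_on m {- 2 * pi<..<2 * pi} (\<lambda>s. vers s powr b * W s - sing_part b N a c s)"
    by (rule sing_part_exists[OF S ck_on_subset[OF W] b, of m]) auto
  have sub: "{-pi..pi} \<subseteq> {- 2 * pi<..<2 * pi}"
  proof
    fix x :: real assume "x \<in> {-pi..pi}"
    then show "x \<in> {- 2 * pi<..<2 * pi}"
      unfolding greaterThanLessThan_iff atLeastAtMost_iff using pi_gt_zero by linarith
  qed
  have per': "vers (s + 2 * pi) powr b * W (s + 2 * pi) - sing_part b N a c (s + 2 * pi) = vers s powr b * W s - sing_part b N a c s" for s
    by (simp add: vers_periodic per sing_part_periodic)
  note D = fourier_decay_bigo[OF sub per' T(3) m]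
  have cW: "continuous_on {-pi..pi} W" using ck_on_imp_continuous_on[OF W[of 0]] continuous_on_subset by blast
  have split: "integral {-pi..pi} (\<lambda>s. vers s powr b * W s * h s) = integral {-pi..pi} (\<lambda>s. (vers s powr b * W s - sing_part b N a c s) * h s)
     + integral {-pi..pi} (\<lambda>s. sing_part b N a c s * h s)" if "continuous_on {-pi..pi} h" for h
    by (subst integral_add[symmetric], (intro integrable_continuous_real continuous_intros continuous_on_vers_powr continuous_on_sing_part cW b that)+)
      (simp add: algebra_simps)
  have cc: "continuous_on {-pi..pi} (\<lambda>s. cos (real k * s))" "continuous_on {-pi..pi} (\<lambda>s. sin (real k * s))" for k
    by (intro continuous_intros)+
  have e: "- (2 * b + 3) = - 2 * b - 3" by simp
  show thesis
  proof
    show "(\<lambda>k. integral {-pi..pi} (\<lambda>s. vers s powr b * W s * cos (real k * s)) - W 0 * vers_const b * real k powr (- 2 * b - 1))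
        \<in> O(\<lambda>k. real k powr (- 2 * b - 3))"
      using sum_in_bigo(1)[OF D(1)[unfolded e] sing_part_fourier_asymp(1)[OF b, of N a c]]
      unfolding split[OF cc(1)] T(1) by (simp add: add_diff_eq)
    show "(\<lambda>k. integral {-pi..pi} (\<lambda>s. vers s powr b * W s * sin (real k * s)) - (c 0 * (- vers_const (b + 1) / (2 * (b + 1)))) * real k powr (- 2 * b - 2))
        \<in> O(\<lambda>k. real k powr (- 2 * b - 3))"
      using sum_in_bigo(1)[OF D(2)[unfolded e] sing_part_fourier_asymp(2)[OF b, of N a c]]
      unfolding split[OF cc(2)] by (simp only: add_diff_eq)
  qed
qed

lemma open_vers_pos: "open {s. vers s > 0}"
  unfolding vers_def by (intro open_Collect_less continuous_intros)

lemma ck_on_sing_part: "ck_on m {s. vers s > 0} (sing_part b N a c)"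
  unfolding sing_part_def[abs_def]
  by (intro ck_on_sum ck_on_mult ck_on_add ck_on_const ck_on_sin ck_on_powr ck_on_vers open_vers_pos) simp

text \<open>For interior \<xi>. The interval for s = t - \<theta> is the one between the
  neighbouring singularities t = -\<theta> and t = 2 pi - \<theta>. The mirror image at -\<theta>
  has the same cosine coefficients, which explains the factor 2.\<close>

lemma fourier_two_singularities:
  assumes b: "b > 0" and \<theta>: "0 < \<theta>" "\<theta> < pi"
    and F: "continuous_on UNIV F" "\<And>t. F (t + 2 * pi) = F t" "\<And>t. F (- t) = F t"
    and W: "\<And>m. ck_on m {- 2 * \<theta><..<2 * pi - 2 * \<theta>} W"
    and FW: "\<And>s. s \<in> {- 2 * \<theta><..<2 * pi - 2 * \<theta>} \<Longrightarrow> F (s + \<theta>) = vers s powr b * W s"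
  obtains B where
    "(\<lambda>k. integral {-pi..pi} (\<lambda>t. F t * cos (real k * t))
        - (2 * W 0 * vers_const b * cos (real k * \<theta>) * real k powr (- 2 * b - 1) + B * sin (real k * \<theta>) * real k powr (- 2 * b - 2)))
        \<in> O(\<lambda>k. real k powr (- 2 * b - 3))"
proof -
  define m where "m = nat \<lceil>2 * b + 3\<rceil>"
  have m: "2 * b + 3 \<le> real m" unfolding m_def by linarith
  define S where "S = {- 2 * \<theta><..<2 * pi - 2 * \<theta>}"
  have S: "open S" "convex S" "0 \<in> S" "S \<subseteq> {-2*pi<..<2*pi}"
    using \<theta> by (auto simp: S_def)
  obtain N a c where T: "a 0 = W 0" "c 0 = deriv W 0"
     "ck_on m S (\<lambda>s. vers s powr b * W s - sing_part b N a c s)"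
    by (rule sing_part_exists[OF S W[folded S_def] b, of m]) auto
  define T where "T = sing_part b N a c"
  \<comment> \<open>D is smooth near theta by the choice of T, hence by evenness near - theta, and these two regions cover the circle.\<close>
  define D where "D = (\<lambda>t. F t - T (t - \<theta>) - T (- t - \<theta>))"
  define S1 where "S1 = {t. 1 * t + (- \<theta>) \<in> S}"
  have S1: "S1 = {- \<theta><..<2 * pi - \<theta>}" by (auto simp: S1_def S_def)
  have o1: "open S1" unfolding S1 by simp
  have "ck_on m S1 (\<lambda>t. vers (1 * t + (- \<theta>)) powr b * W (1 * t + (- \<theta>)) - T (1 * t + (- \<theta>)))"
    unfolding S1_def T_def using ck_on_affine[OF S(1) T(3), of 1 "- \<theta>"] by simp
  then have 1: "ck_on m S1 (\<lambda>t. F t - T (t - \<theta>))"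
  proof (rule ck_on_cong[OF o1, rotated])
    fix t assume "t \<in> S1"
    then show "vers (1 * t + (- \<theta>)) powr b * W (1 * t + (- \<theta>)) - T (1 * t + (- \<theta>)) = F t - T (t - \<theta>)"
      using FW[of "t - \<theta>"] by (simp add: S1_def S_def)
  qed
  \<comment> \<open>The mirrored singular part is singular only at -\<theta> modulo 2 pi, which are
    points outside S1, so subtracting it does no harm on S1.\<close>
  have "ck_on m {t. (- 1) * t + (- \<theta>) \<in> {s. vers s > 0}} (\<lambda>t. T ((- 1) * t + (- \<theta>)))"
    unfolding T_def by (rule ck_on_affine[OF open_vers_pos ck_on_sing_part])
  moreover have "S1 \<subseteq> {t. (- 1) * t + (- \<theta>) \<in> {s. vers s > 0}}"
  proof
    fix t assume "t \<in> S1"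
    then have "vers (t + \<theta>) > 0" by (intro vers_pos) (auto simp: S1 abs_if)
    then show "t \<in> {t. (- 1) * t + (- \<theta>) \<in> {s. vers s > 0}}"
      using vers_minus[of "t + \<theta>"] by simp
  qed
  ultimately have "ck_on m S1 (\<lambda>t. T ((- 1) * t + (- \<theta>)))"
    by (rule ck_on_subset)
  then have "ck_on m S1 (\<lambda>t. T (- t - \<theta>))" by simp
  from ck_on_diff[OF o1 1 this] have D1: "ck_on m S1 D" by (simp add: D_def)
  have Deven: "D (- t) = D t" for t by (simp add: D_def F(3))
  define S2 where "S2 = {t. (- 1) * t + 0 \<in> S1}"
  have S2: "S2 = {\<theta> - 2 * pi<..<\<theta>}" by (auto simp: S2_def S1)
  have "ck_on m S2 (\<lambda>t. D ((- 1) * t + 0))"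
    unfolding S2_def by (rule ck_on_affine[OF o1 D1])
  then have D2: "ck_on m S2 D" by (simp add: Deven)
  have Dm: "ck_on m (S1 \<union> S2) D"
    by (rule ck_on_Un[OF o1 _ D1 D2]) (simp add: S2)
  have sub: "{-pi..pi} \<subseteq> S1 \<union> S2" using \<theta> by (auto simp: S1 S2)
  have Tper: "T (x + 2 * pi) = T x" for x by (simp add: T_def sing_part_periodic)
  have Dper: "D (t + 2 * pi) = D t" for t
  proof -
    have "T (t + 2 * pi - \<theta>) = T (t - \<theta>)" using Tper[of "t - \<theta>"] by (simp add: algebra_simps)
    moreover have "T (- (t + 2 * pi) - \<theta>) = T (- t - \<theta>)" proof -
      have "- (t + 2 * pi) - \<theta> + 2 * pi = - t - \<theta>" by simp
      with Tper[of "- (t + 2 * pi) - \<theta>"] show ?thesis by (simp only:)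
    qed
    ultimately show ?thesis by (simp add: D_def F(2))
  qed
  have e: "- (2 * b + 3) = - 2 * b - 3" by simp
  note Dbig = fourier_decay_bigo(1)[OF sub Dper Dm m, unfolded e]
  have cT: "continuous_on X T" for X unfolding T_def by (rule continuous_on_sing_part[OF b])
  have cT': "continuous_on X (\<lambda>t. T (x * t - \<theta>))" for X x
    by (rule continuous_on_compose2[OF cT[of UNIV]]) (auto intro!: continuous_intros)
  have cF: "continuous_on X F" for X using F(1) continuous_on_subset by blast
  have cD: "continuous_on {-pi..pi} D"
    using continuous_on_subset[OF ck_on_imp_continuous_on[OF Dm] sub] .
  define X where "X = (\<lambda>k. integral {-pi..pi} (\<lambda>s. T s * cos (real k * s)))"
  define Y where "Y = (\<lambda>k. integral {-pi..pi} (\<lambda>s. T s * sin (real k * s)))"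
  have eq: "integral {-pi..pi} (\<lambda>t. F t * cos (real k * t)) = integral {-pi..pi} (\<lambda>t. D t * cos (real k * t))
      + 2 * (cos (real k * \<theta>) * X k - sin (real k * \<theta>) * Y k)" for k
  proof -
    have sh: "integral {-pi..pi} (\<lambda>t. T (t - \<theta>) * cos (real k * t)) = cos (real k * \<theta>) * X k - sin (real k * \<theta>) * Y k"
      unfolding X_def Y_def by (rule fourier_cos_shift[OF cT Tper]) (use \<theta> in auto)
    have "integral {-pi..pi} (\<lambda>t. T (- t - \<theta>) * cos (real k * t)) = integral {-pi..pi} (\<lambda>t. T (t - \<theta>) * cos (real k * t))"
      using Henstock_Kurzweil_Integration.integral_reflect_real[of pi "- pi" "\<lambda>t. T (t - \<theta>) * cos (real k * t)"] by simp
    moreover have "integral {-pi..pi} (\<lambda>t. F t * cos (real k * t)) =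
       integral {-pi..pi} (\<lambda>t. D t * cos (real k * t) + T (t - \<theta>) * cos (real k * t) + T (- t - \<theta>) * cos (real k * t))"
      by (simp add: D_def algebra_simps)
    moreover have "\<dots> = integral {-pi..pi} (\<lambda>t. D t * cos (real k * t)) + integral {-pi..pi} (\<lambda>t. T (t - \<theta>) * cos (real k * t))
       + integral {-pi..pi} (\<lambda>t. T (- t - \<theta>) * cos (real k * t))"
    proof -
      have i: "(\<lambda>t. D t * cos (real k * t)) integrable_on {-pi..pi}" "(\<lambda>t. T (t - \<theta>) * cos (real k * t)) integrable_on {-pi..pi}"
        "(\<lambda>t. T (- t - \<theta>) * cos (real k * t)) integrable_on {-pi..pi}"
        using cT'[of _ 1] cT'[of _ "- 1"] by (auto intro!: integrable_continuous_real continuous_on_mult cD continuous_intros)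
      show ?thesis
        by (simp add: integral_add[OF integrable_add[OF i(1,2)] i(3)] integral_add[OF i(1,2)])
    qed
    ultimately show ?thesis using sh by simp
  qed
  define C where "C = c 0 * (- vers_const (b + 1) / (2 * (b + 1)))"
  have X: "(\<lambda>k. X k - W 0 * vers_const b * real k powr (- 2 * b - 1)) \<in> O(\<lambda>k. real k powr (- 2 * b - 3))"
    using sing_part_fourier_asymp(1)[OF b, of N a c] by (simp add: X_def T_def T(1))
  have Y: "(\<lambda>k. Y k - C * real k powr (- 2 * b - 2)) \<in> O(\<lambda>k. real k powr (- 2 * b - 3))"
    using sing_part_fourier_asymp(2)[OF b, of N a c] by (simp add: Y_def T_def C_def)
  have bc: "(\<lambda>k. cos (real k * \<theta>)) \<in> O(\<lambda>_. 1)" "(\<lambda>k. sin (real k * \<theta>)) \<in> O(\<lambda>_. 1)"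
    by (auto intro!: bigoI[of _ 1])
  have "(\<lambda>k. 2 * (cos (real k * \<theta>) * (X k - W 0 * vers_const b * real k powr (- 2 * b - 1)))
      - 2 * (sin (real k * \<theta>) * (Y k - C * real k powr (- 2 * b - 2)))) \<in> O(\<lambda>k. real k powr (- 2 * b - 3))"
    using landau_o.big.mult[OF bc(1) X] landau_o.big.mult[OF bc(2) Y]
    by (intro sum_in_bigo(2) bigo_cmult) simp_all
  from sum_in_bigo(1)[OF Dbig this]
  have "(\<lambda>k. integral {-pi..pi} (\<lambda>t. F t * cos (real k * t))
        - (2 * W 0 * vers_const b * cos (real k * \<theta>) * real k powr (- 2 * b - 1) + (- 2 * C) * sin (real k * \<theta>) * real k powr (- 2 * b - 2)))
        \<in> O(\<lambda>k. real k powr (- 2 * b - 3))"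
    unfolding eq by (simp add: algebra_simps)
  then show thesis by (rule that)
qed

section \<open>Tails of trigonometric series\<close>

text \<open>The tail beyond n loses x (n+1) when n grows by 1. If A does the same up to O(n^(-p-1)),
  then tail minus A tends to 0 with small differences, and \<open>telescoping_bigo\<close> applies.
  Estimating a tail thus reduces to guessing A and checking a single step.\<close>

lemma tail_sum_bigo:
  fixes x A :: "nat \<Rightarrow> real"
  assumes x: "summable x" and A: "A \<longlonglongrightarrow> 0" and p: "p > 0"
    and diff: "(\<lambda>n. A n - A (Suc n) - x (Suc n)) \<in> O(\<lambda>n. real n powr (- p - 1))"
  shows "(\<lambda>n. suminf x - (\<Sum>k\<le>n. x k) - A n) \<in> O(\<lambda>n. real n powr (- p))"
proof (rule telescoping_bigo[OF _ p])
  have "(\<lambda>n. suminf x - (\<Sum>k\<le>n. x k) - A n) \<longlonglongrightarrow> suminf x - suminf x - 0"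
    by (intro tendsto_intros summable_LIMSEQ' x A)
  then show "(\<lambda>n. suminf x - (\<Sum>k\<le>n. x k) - A n) \<longlonglongrightarrow> 0" by simp
  have "(\<lambda>n. - (A n - A (Suc n) - x (Suc n))) \<in> O(\<lambda>n. real n powr (- p - 1))"
    using diff by (simp only: landau_o.big.uminus_in_iff)
  then show "(\<lambda>n. suminf x - (\<Sum>k\<le>n. x k) - A n - (suminf x - (\<Sum>k\<le>Suc n. x k) - A (Suc n))) \<in> O(\<lambda>n. real n powr (- p - 1))"
    by (simp add: algebra_simps)
qed

lemma sin_multiple_eq_0:
  assumes "sin \<phi> = 0"
  shows "sin (real k * \<phi>) = 0"
proof (induction k)
  case (Suc k)
  have "real (Suc k) * \<phi> = real k * \<phi> + \<phi>" by (simp add: algebra_simps)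
  then show ?case using Suc assms by (simp add: sin_add)
qed simp

text \<open>The approximate sum of cos(2k\<phi>) k^(-s) over k > n. For \<phi> a multiple of pi
  these are the first two Euler-Maclaurin terms; otherwise the quotient of sines is half the
  Dirichlet kernel, which is also U_2n(cos \<phi>) / 2.\<close>

definition cos_tail :: "real \<Rightarrow> real \<Rightarrow> nat \<Rightarrow> real" where
  "cos_tail s \<phi> n = (if sin \<phi> = 0 then real n powr (1 - s) / (s - 1) - real n powr (- s) / 2
     else - (sin (real (2 * n + 1) * \<phi>) / (2 * sin \<phi>)) * real n powr (- s))"

lemma summable_trig_powr:
  assumes "s > 1" "\<And>k. \<bar>u k\<bar> \<le> 1"
  shows "summable (\<lambda>k. u k * real k powr (- s))"
proof (rule summable_comparison_test')
  show "summable (\<lambda>k. real k powr (- s))" using assms(1) by (simp add: summable_real_powr_iff)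
  show "norm (u k * real k powr (- s)) \<le> real k powr (- s)" if "k \<ge> 0" for k
    using mult_right_mono[OF assms(2)[of k], of "real k powr (- s)"] by (simp add: abs_mult)
qed

lemma bounded_mult_powr_tendsto_0:
  fixes u :: "nat \<Rightarrow> real"
  assumes "u \<in> O(\<lambda>_. 1)" "e > 0"
  shows "(\<lambda>n. u n * real n powr (- e)) \<longlonglongrightarrow> 0"
proof -
  have "(\<lambda>n. real n powr (- e)) \<in> o(\<lambda>_. 1)" using assms(2) by real_asymp
  from landau_o.big_small_mult[OF assms(1) this] show ?thesis by (auto dest: smalloD_tendsto)
qed

text \<open>The series may be written over all k because \<open>0 powr (- s) = 0\<close> makes the
  term k = 0 vanish.\<close>

lemma cos_tail_asymp:
  assumes s: "s > 1"
  shows "(\<lambda>n. (\<Sum>k. cos (2 * real k * \<phi>) * real k powr (- s)) - (\<Sum>k\<le>n. cos (2 * real k * \<phi>) * real k powr (- s))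
      - cos_tail s \<phi> n) \<in> O(\<lambda>n. real n powr (- s - 1))"
proof (cases "sin \<phi> = 0")
  case True
  have c: "cos (2 * real k * \<phi>) = 1" for k
    using cos_double_sin[of "real k * \<phi>"] sin_multiple_eq_0[OF True, of k] by (simp add: mult.assoc)
  define A where "A = (\<lambda>n. real n powr (1 - s) / (s - 1) - real n powr (- s) / 2)"
  have "(\<lambda>n. suminf (\<lambda>k. real k powr (- s)) - (\<Sum>k\<le>n. real k powr (- s)) - A n) \<in> O(\<lambda>n. real n powr (- (s + 1)))"
  proof (rule tail_sum_bigo)
    show "summable (\<lambda>k. real k powr (- s))" using s by (simp add: summable_real_powr_iff)
    show "A \<longlonglongrightarrow> 0" unfolding A_def using s by real_asymp
    show "(\<lambda>n. A n - A (Suc n) - real (Suc n) powr (- s)) \<in> O(\<lambda>n. real n powr (- (s + 1) - 1))"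
      unfolding A_def of_nat_Suc using s by (real_asymp simp: field_simps)
  qed (use s in simp)
  then show ?thesis by (simp add: c cos_tail_def True A_def)
next
  case False
  \<comment> \<open>d and - h / s are successive discrete antiderivatives of the cosine: two summations by parts.\<close>
  define d where "d = (\<lambda>n::nat. sin (real (2 * n + 1) * \<phi>) / (2 * sin \<phi>))"
  define h where "h = (\<lambda>n::nat. s * cos (2 * real n * \<phi>) / (4 * (sin \<phi>)\<^sup>2))"
  define A where "A = (\<lambda>n. - d n * real n powr (- s) + h n * real n powr (- s - 1))"
  have d_diff: "d (Suc n) - d n = cos (2 * real (Suc n) * \<phi>)" for n
  proof -
    have "real (2 * Suc n + 1) * \<phi> = 2 * real (Suc n) * \<phi> + \<phi>" "real (2 * n + 1) * \<phi> = 2 * real (Suc n) * \<phi> - \<phi>"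
      by (simp_all add: algebra_simps)
    then show ?thesis unfolding d_def using False by (simp add: sin_add sin_diff diff_divide_distrib[symmetric] del: of_nat_Suc)
  qed
  have h_diff: "h n - h (Suc n) = s * d n" for n
  proof -
    have "2 * real (Suc n) * \<phi> = real (2 * n + 1) * \<phi> + \<phi>" "2 * real n * \<phi> = real (2 * n + 1) * \<phi> - \<phi>"
      by (simp_all add: algebra_simps)
    then have "h n - h (Suc n) = s * (2 * sin (real (2 * n + 1) * \<phi>) * sin \<phi>) / (4 * (sin \<phi>)\<^sup>2)"
      unfolding h_def by (simp add: cos_add cos_diff diff_divide_distrib[symmetric] right_diff_distrib[symmetric] del: of_nat_Suc of_nat_add)
    then show ?thesis unfolding d_def using False by (simp add: power2_eq_square)
  qed
  have db: "d \<in> O(\<lambda>_. 1)"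
    by (rule bigoI[of _ "1 / \<bar>2 * sin \<phi>\<bar>"]) (simp add: d_def abs_divide divide_right_mono)
  have hb: "h \<in> O(\<lambda>_. 1)"
    by (rule bigoI[of _ "\<bar>s\<bar> / \<bar>4 * (sin \<phi>)\<^sup>2\<bar>"]) (simp add: h_def abs_divide abs_mult divide_right_mono mult_left_le)
  have hSb: "(\<lambda>n. h (Suc n)) \<in> O(\<lambda>_. 1)"
    by (rule bigoI[of _ "\<bar>s\<bar> / \<bar>4 * (sin \<phi>)\<^sup>2\<bar>"]) (simp add: h_def abs_divide abs_mult divide_right_mono mult_left_le)
  have "(\<lambda>n. suminf (\<lambda>k. cos (2 * real k * \<phi>) * real k powr (- s)) - (\<Sum>k\<le>n. cos (2 * real k * \<phi>) * real k powr (- s)) - A n) \<in> O(\<lambda>n. real n powr (- (s + 1)))"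
  proof (rule tail_sum_bigo)
    show "summable (\<lambda>k. cos (2 * real k * \<phi>) * real k powr (- s))"
      by (rule summable_trig_powr[OF s]) simp
    have "A \<longlonglongrightarrow> 0 + 0"
      unfolding A_def using bounded_mult_powr_tendsto_0[of "\<lambda>n. - d n" s]
        bounded_mult_powr_tendsto_0[of h "s + 1"] s db hb by (intro tendsto_add) simp_all
    then show "A \<longlonglongrightarrow> 0" by simp
    \<comment> \<open>Summation by parts leaves d n times the increment of n^(-s), which is only
      O(n^(-s-1)). Its main part -s n^(-s-1) is cancelled by the difference of the h-terms, so both
      brackets are O(n^(-s-2)).\<close>
    have eq: "A n - A (Suc n) - cos (2 * real (Suc n) * \<phi>) * real (Suc n) powr (- s)
       = d n * ((real n + 1) powr (- s) - real n powr (- s) + s * real n powr (- s - 1))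
         + h (Suc n) * (real n powr (- s - 1) - (real n + 1) powr (- s - 1))" for n
    proof -
      have hn: "h n = h (Suc n) + s * d n" using h_diff[of n] by simp
      show ?thesis unfolding A_def d_diff[symmetric] hn by (simp add: algebra_simps)
    qed
    have r1: "(\<lambda>n. (real n + 1) powr (- s) - real n powr (- s) + s * real n powr (- s - 1)) \<in> O(\<lambda>n. real n powr (- s - 2))"
      using s by (real_asymp simp: field_simps)
    have r2: "(\<lambda>n. real n powr (- s - 1) - (real n + 1) powr (- s - 1)) \<in> O(\<lambda>n. real n powr (- s - 2))"
      using s by (real_asymp simp: field_simps)
    have e: "- (s + 1) - 1 = - s - 2" by simp
    show "(\<lambda>n. A n - A (Suc n) - cos (2 * real (Suc n) * \<phi>) * real (Suc n) powr (- s)) \<in> O(\<lambda>n. real n powr (- (s + 1) - 1))"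
      unfolding eq e using landau_o.big.mult[OF db r1] landau_o.big.mult[OF hSb r2]
      by (intro sum_in_bigo(1)) simp_all
  qed (use s in simp)
  moreover have "(\<lambda>n. h n * real n powr (- s - 1)) \<in> O(\<lambda>n. real n powr (- s - 1))"
    using landau_o.big.mult[OF hb landau_o.big_refl[of "\<lambda>n. real n powr (- s - 1)"]] by simp
  ultimately have "(\<lambda>n. (suminf (\<lambda>k. cos (2 * real k * \<phi>) * real k powr (- s)) - (\<Sum>k\<le>n. cos (2 * real k * \<phi>) * real k powr (- s)) - A n) + h n * real n powr (- s - 1)) \<in> O(\<lambda>n. real n powr (- s - 1))"
    by (intro sum_in_bigo(1)) simp_all
  then show ?thesis by (simp add: cos_tail_def False A_def d_def algebra_simps)
qed

text \<open>There is no exceptional angle here: when sin \<phi> = 0 all terms are 0, and otherwise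
  one summation by parts gives the bound.\<close>

lemma sin_tail_asymp:
  assumes s: "s > 1"
  shows "(\<lambda>n. (\<Sum>k. sin (2 * real k * \<phi>) * real k powr (- s)) - (\<Sum>k\<le>n. sin (2 * real k * \<phi>) * real k powr (- s)))
      \<in> O(\<lambda>n. real n powr (- s))"
proof (cases "sin \<phi> = 0")
  case True
  have c: "sin (2 * real k * \<phi>) = 0" for k
    using sin_double[of "real k * \<phi>"] sin_multiple_eq_0[OF True, of k] by (simp add: mult.assoc)
  show ?thesis by (simp add: c)
next
  case False
  define d where "d = (\<lambda>n::nat. - cos (real (2 * n + 1) * \<phi>) / (2 * sin \<phi>))"
  have d_diff: "d (Suc n) - d n = sin (2 * real (Suc n) * \<phi>)" for n
  proof -
    have "real (2 * Suc n + 1) * \<phi> = 2 * real (Suc n) * \<phi> + \<phi>" "real (2 * n + 1) * \<phi> = 2 * real (Suc n) * \<phi> - \<phi>"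
      by (simp_all add: algebra_simps)
    then show ?thesis unfolding d_def using False by (simp add: cos_add cos_diff diff_divide_distrib[symmetric] del: of_nat_Suc)
  qed
  have db: "d \<in> O(\<lambda>_. 1)"
    by (rule bigoI[of _ "1 / \<bar>2 * sin \<phi>\<bar>"]) (simp add: d_def abs_divide divide_right_mono)
  define A where "A = (\<lambda>n. - (d n * real n powr (- s)))"
  have Ab: "A \<in> O(\<lambda>n. real n powr (- s))"
    unfolding A_def using landau_o.big.mult[OF db landau_o.big_refl[of "\<lambda>n. real n powr (- s)"]] by simp
  have "(\<lambda>n. suminf (\<lambda>k. sin (2 * real k * \<phi>) * real k powr (- s)) - (\<Sum>k\<le>n. sin (2 * real k * \<phi>) * real k powr (- s)) - A n) \<in> O(\<lambda>n. real n powr (- s))"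
  proof (rule tail_sum_bigo)
    show "summable (\<lambda>k. sin (2 * real k * \<phi>) * real k powr (- s))"
      by (rule summable_trig_powr[OF s]) simp
    show "A \<longlonglongrightarrow> 0"
      unfolding A_def using bounded_mult_powr_tendsto_0[OF db, of s] s by (simp add: tendsto_minus_cancel_left[symmetric])
    have eq: "A n - A (Suc n) - sin (2 * real (Suc n) * \<phi>) * real (Suc n) powr (- s)
       = d n * ((real n + 1) powr (- s) - real n powr (- s))" for n
      unfolding A_def d_diff[symmetric] by (simp add: algebra_simps)
    have r1: "(\<lambda>n. (real n + 1) powr (- s) - real n powr (- s)) \<in> O(\<lambda>n. real n powr (- s - 1))"
      using s by (real_asymp simp: field_simps)
    show "(\<lambda>n. A n - A (Suc n) - sin (2 * real (Suc n) * \<phi>) * real (Suc n) powr (- s)) \<in> O(\<lambda>n. real n powr (- s - 1))"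
      unfolding eq using landau_o.big.mult[OF db r1] by simp
  qed (use s in simp)
  from sum_in_bigo(1)[OF this Ab] show ?thesis by simp
qed

section \<open>Convergence of the Chebyshev series\<close>

lemma cheb_coeff_eq_cos:
  assumes "continuous_on {-1..1} f"
  shows "cheb_coeff f k = 2 / pi * integral {0..pi} (\<lambda>t. f (cos t) * cos (real k * t))"
proof -
  have "continuous_on {0..pi} (\<lambda>t. f (cos t) * cos (real k * t))"
    by (intro continuous_intros continuous_on_compose2[OF assms]) auto
  from integral_arccos_substitution[OF this]
  have "((\<lambda>x. f x * cheb_T k x / sqrt (1 - x\<^sup>2)) has_integral integral {0..pi} (\<lambda>t. f (cos t) * cos (real k * t))) {-1..1}"
    by (rule has_integral_eq[rotated]) (simp add: cheb_T_def)
  then show ?thesis unfolding cheb_coeff_def by (simp add: integral_unique)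
qed

lemma cheb_coeff_eq_fourier:
  assumes "continuous_on {-1..1} f"
  shows "cheb_coeff f k = 1 / pi * integral {-pi..pi} (\<lambda>t. f (cos t) * cos (real k * t))"
proof -
  have "continuous_on {-pi..pi} (\<lambda>t. f (cos t) * cos (real k * t))"
    by (intro continuous_intros continuous_on_compose2[OF assms]) auto
  from integral_even[OF this] show ?thesis
    unfolding cheb_coeff_eq_cos[OF assms] by simp
qed

text \<open>Integer frequencies, because the difference of two indices may be negative.\<close>

lemma integral_cos_multiple:
  "integral {0..pi} (\<lambda>t. cos (of_int j * t)) = (if j = 0 then pi else 0)"
proof (cases "j = 0")
  case False
  have "((\<lambda>t. cos (of_int j * t)) has_integral sin (of_int j * pi) / of_int j - sin (of_int j * 0) / of_int j) {0..pi}"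
  proof (rule fundamental_theorem_of_calculus)
    fix t :: real
    have "((\<lambda>t. sin (of_int j * t) / of_int j) has_real_derivative cos (of_int j * t)) (at t)"
      using False by (auto intro!: derivative_eq_intros)
    then show "((\<lambda>t. sin (of_int j * t) / of_int j) has_vector_derivative cos (of_int j * t)) (at t within {0..pi})"
      unfolding has_real_derivative_iff_has_vector_derivative[symmetric] by (rule has_field_derivative_at_within)
  qed simp
  moreover have "sin (of_int j * pi) = 0"
    using sin_int_times_real[of j] by (simp add: sin_zero_iff_int2)
  ultimately show ?thesis using False by (simp add: integral_unique)
qed simp

lemma integral_cos_mult_cos:
  "integral {0..pi} (\<lambda>t. cos (real i * t) * cos (real k * t)) = (if i = k then if k = 0 then pi else pi / 2 else 0)"
proof -
  have "(\<lambda>t. cos (real i * t) * cos (real k * t)) = (\<lambda>t. (1 / 2) * cos (of_int (int i - int k) * t) + (1 / 2) * cos (of_int (int i + int k) * t))"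
    by (simp add: cos_times_cos add_divide_distrib algebra_simps)
  moreover have "integral {0..pi} \<dots> = (1 / 2) * integral {0..pi} (\<lambda>t. cos (of_int (int i - int k) * t)) + (1 / 2) * integral {0..pi} (\<lambda>t. cos (of_int (int i + int k) * t))"
    by (subst integral_add, (intro integrable_continuous_real continuous_intros)+) (simp only: integral_mult_right)
  ultimately show ?thesis unfolding integral_cos_multiple by auto
qed

text \<open>H is orthogonal to all polynomials in cos t, which approximate H uniformly, so the integral of H^2 vanishes.\<close>

lemma cos_fourier_unique:
  fixes H :: "real \<Rightarrow> real"
  assumes H: "continuous_on {0..pi} H" and zero: "\<And>k. integral {0..pi} (\<lambda>t. H t * cos (real k * t)) = 0"
    and t: "t \<in> {0..pi}"
  shows "H t = 0"
proof -
  have int: "(\<lambda>t. H t * u t) integrable_on {0..pi}" if "continuous_on {0..pi} u" for u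
    by (intro integrable_continuous_real continuous_intros H that)
  \<comment> \<open>Powers of cos t are absorbed one at a time through cos t cos(kt) = (cos((k-1)t)
    + cos((k+1)t)) / 2, so k must vary; k = 0 is separate because k - 1 would be negative.\<close>
  have pow: "integral {0..pi} (\<lambda>t. H t * (cos t ^ i * cos (real k * t))) = 0" for i k
  proof (induction i arbitrary: k)
    case 0
    then show ?case using zero by simp
  next
    case (Suc i)
    show ?case
    proof (cases k)
      case 0
      then show ?thesis using Suc[of 1] by (simp add: mult_ac)
    next
      case (Suc l)
      have c: "cos t * cos (real k * t) = (1 / 2) * cos (real l * t) + (1 / 2) * cos (real (Suc k) * t)" for t
        using cos_add[of "real k * t" t] cos_diff[of "real k * t" t] Suc by (simp add: algebra_simps)
      have "(\<lambda>t. H t * (cos t ^ Suc i * cos (real k * t))) =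
          (\<lambda>t. (1 / 2) * (H t * (cos t ^ i * cos (real l * t))) + (1 / 2) * (H t * (cos t ^ i * cos (real (Suc k) * t))))"
      proof
        fix t
        have "H t * (cos t ^ Suc i * cos (real k * t)) = H t * (cos t ^ i * (cos t * cos (real k * t)))"
          by (simp add: mult_ac)
        then show "H t * (cos t ^ Suc i * cos (real k * t)) = (1 / 2) * (H t * (cos t ^ i * cos (real l * t))) + (1 / 2) * (H t * (cos t ^ i * cos (real (Suc k) * t)))"
          unfolding c by (simp add: algebra_simps)
      qed
      moreover have "integral {0..pi} \<dots> = (1 / 2) * integral {0..pi} (\<lambda>t. H t * (cos t ^ i * cos (real l * t))) + (1 / 2) * integral {0..pi} (\<lambda>t. H t * (cos t ^ i * cos (real (Suc k) * t)))"
        by (subst integral_add, (intro integrable_continuous_real continuous_intros H)+) (simp only: integral_mult_right)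
      ultimately show ?thesis by (simp only: Suc.IH)
    qed
  qed
  have cont2: "continuous_on {0..pi} (\<lambda>t. (H t)\<^sup>2)" by (intro continuous_intros H)
  have bound: "integral {0..pi} (\<lambda>t. (H t)\<^sup>2) \<le> e * integral {0..pi} (\<lambda>t. \<bar>H t\<bar>)" if e: "e > 0" for e
  proof -
    have "continuous_on {-1..1} (\<lambda>x. H (arccos x))"
      by (intro continuous_on_compose2[OF H] continuous_on_arccos') (auto simp: arccos_lbound arccos_ubound)
    from Stone_Weierstrass_real_polynomial_function[OF compact_Icc this e]
    obtain g where g: "real_polynomial_function g" "\<And>x. x \<in> {-1..1} \<Longrightarrow> \<bar>H (arccos x) - g x\<bar> < e"
      by metis
    obtain a n where an: "g = (\<lambda>x. \<Sum>i\<le>n. a i * x ^ i)"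
      using g(1) unfolding real_polynomial_function_iff_sum by blast
    have gc: "\<bar>H t - g (cos t)\<bar> \<le> e" if "t \<in> {0..pi}" for t
      using g(2)[of "cos t"] that by (simp add: arccos_cos)
    have cg: "continuous_on {0..pi} (\<lambda>t. g (cos t))" unfolding an by (intro continuous_intros)
    have "integral {0..pi} (\<lambda>t. H t * g (cos t)) = integral {0..pi} (\<lambda>t. \<Sum>i\<le>n. a i * (H t * (cos t ^ i * cos (real 0 * t))))"
      unfolding an by (simp add: sum_distrib_left mult_ac)
    also have "\<dots> = (\<Sum>i\<le>n. integral {0..pi} (\<lambda>t. a i * (H t * (cos t ^ i * cos (real 0 * t)))))"
      by (intro integral_sum integrable_continuous_real continuous_intros H) simp
    also have "\<dots> = 0" by (simp only: integral_mult_right pow) simp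
    finally have z: "integral {0..pi} (\<lambda>t. H t * g (cos t)) = 0" .
    have "integral {0..pi} (\<lambda>t. (H t)\<^sup>2) = integral {0..pi} (\<lambda>t. H t * (H t - g (cos t)) + H t * g (cos t))"
      by (simp add: power2_eq_square algebra_simps)
    also have "\<dots> = integral {0..pi} (\<lambda>t. H t * (H t - g (cos t)))"
      by (subst integral_add, (intro int continuous_intros H cg)+) (simp add: z)
    also have "\<dots> \<le> integral {0..pi} (\<lambda>t. e * \<bar>H t\<bar>)"
    proof (rule integral_le)
      show "(\<lambda>t. H t * (H t - g (cos t))) integrable_on {0..pi}" by (intro int continuous_intros H cg)
      show "(\<lambda>t. e * \<bar>H t\<bar>) integrable_on {0..pi}" by (intro integrable_continuous_real continuous_intros H)
      fix t assume "t \<in> {0..pi}"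
      from mult_left_mono[OF gc[OF this], of "\<bar>H t\<bar>"]
      have "\<bar>H t * (H t - g (cos t))\<bar> \<le> e * \<bar>H t\<bar>" by (simp add: abs_mult mult.commute)
      then show "H t * (H t - g (cos t)) \<le> e * \<bar>H t\<bar>" by linarith
    qed
    also have "\<dots> = e * integral {0..pi} (\<lambda>t. \<bar>H t\<bar>)" by (rule integral_mult_right)
    finally show ?thesis .
  qed
  have "((\<lambda>e. e * integral {0..pi} (\<lambda>t. \<bar>H t\<bar>)) \<longlongrightarrow> 0 * integral {0..pi} (\<lambda>t. \<bar>H t\<bar>)) (at_right 0)"
    by (intro tendsto_intros)
  moreover have "eventually (\<lambda>e. integral {0..pi} (\<lambda>t. (H t)\<^sup>2) \<le> e * integral {0..pi} (\<lambda>t. \<bar>H t\<bar>)) (at_right 0)"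
    using bound by (auto simp: eventually_at_filter)
  ultimately have "integral {0..pi} (\<lambda>t. (H t)\<^sup>2) \<le> 0"
    using tendsto_lowerbound[of _ "0 * integral {0..pi} (\<lambda>t. \<bar>H t\<bar>)" "at_right (0::real)"] by simp
  moreover have "integral {0..pi} (\<lambda>t. (H t)\<^sup>2) \<ge> 0"
    by (intro integral_nonneg integrable_continuous_real cont2) simp
  ultimately have "integral {0..pi} (\<lambda>t. (H t)\<^sup>2) = 0" by simp
  then have "\<forall>t\<in>{0..pi}. (H t)\<^sup>2 = 0"
    by (subst (asm) integral_eq_0_iff) (use cont2 in auto)
  then show ?thesis using t by auto
qed

text \<open>Absolute summability makes the series converge uniformly to a continuous G with the same
  cosine coefficients as f(cos t). Uniqueness then gives equality at every point, the endpoints and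
  \<xi> included.\<close>

lemma cheb_series_LIMSEQ:
  assumes f: "continuous_on {-1..1} f" and sm: "summable (\<lambda>k. \<bar>cheb_coeff f k\<bar>)" and x: "x \<in> {-1..1}"
  shows "(\<lambda>n. cheb_proj f n x) \<longlonglongrightarrow> f x"
proof -
  define c where "c = (\<lambda>k::nat. if k = 0 then cheb_coeff f 0 / 2 else cheb_coeff f k)"
  define s where "s = (\<lambda>n t. \<Sum>i<n. c i * cos (real i * t))"
  define G where "G = (\<lambda>t. \<Sum>i. c i * cos (real i * t))"
  define F where "F = (\<lambda>t. f (cos t))"
  have cF: "continuous_on {0..pi} F"
    unfolding F_def by (intro continuous_on_compose2[OF f] continuous_intros) auto
  have cs: "continuous_on {0..pi} (s n)" for n unfolding s_def by (intro continuous_intros)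
  have u: "uniform_limit {0..pi} s G sequentially"
    unfolding s_def G_def
  proof (rule Weierstrass_m_test[OF _ sm])
    fix n t
    have "\<bar>c n\<bar> * \<bar>cos (real n * t)\<bar> \<le> \<bar>c n\<bar> * 1" by (intro mult_left_mono) auto
    also have "\<bar>c n\<bar> * 1 \<le> \<bar>cheb_coeff f n\<bar>" by (simp add: c_def)
    finally show "norm (c n * cos (real n * t)) \<le> \<bar>cheb_coeff f n\<bar>" by (simp add: abs_mult)
  qed
  have cG: "continuous_on {0..pi} G"
    by (rule uniform_limit_theorem[OF _ u]) (use cs in auto)
  have zero: "integral {0..pi} (\<lambda>t. (F t - G t) * cos (real k * t)) = 0" for k
  proof -
    have ul: "uniform_limit {0..pi} (\<lambda>n t. (F t - s n t) * cos (real k * t)) (\<lambda>t. (F t - G t) * cos (real k * t)) sequentially"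
    proof (rule uniform_limitI)
      fix e :: real assume "e > 0"
      from uniform_limitD[OF u this]
      show "\<forall>\<^sub>F n in sequentially. \<forall>t\<in>{0..pi}. dist ((F t - s n t) * cos (real k * t)) ((F t - G t) * cos (real k * t)) < e"
      proof eventually_elim
        case (elim n)
        show ?case
        proof
          fix t assume "t \<in> {0..pi}"
          have "dist ((F t - s n t) * cos (real k * t)) ((F t - G t) * cos (real k * t)) = \<bar>s n t - G t\<bar> * \<bar>cos (real k * t)\<bar>"
            by (simp add: dist_real_def abs_mult[symmetric] algebra_simps abs_minus_commute)
          also have "\<dots> \<le> \<bar>s n t - G t\<bar> * 1" by (intro mult_left_mono) auto
          also have "\<dots> < e" using elim \<open>t \<in> {0..pi}\<close> by (simp add: dist_real_def)
          finally show "dist ((F t - s n t) * cos (real k * t)) ((F t - G t) * cos (real k * t)) < e" .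
        qed
      qed
    qed
    obtain I J where I: "\<And>n. ((\<lambda>t. (F t - s n t) * cos (real k * t)) has_integral I n) {0..pi}"
      and J: "((\<lambda>t. (F t - G t) * cos (real k * t)) has_integral J) {0..pi}" and IJ: "I \<longlonglongrightarrow> J"
      by (rule uniform_limit_integral[OF ul]) (auto intro!: continuous_intros cF cs)
    \<comment> \<open>Once n > k, the partial sum contains the k-th term, so the k-th coefficient of
      the difference is exactly 0 and the limit is trivial.\<close>
    have I0: "I n = 0" if n: "n > k" for n
    proof -
      have "integral {0..pi} (\<lambda>t. s n t * cos (real k * t)) = integral {0..pi} (\<lambda>t. \<Sum>i<n. c i * (cos (real i * t) * cos (real k * t)))"
        unfolding s_def by (simp only: sum_distrib_right mult.assoc)
      also have "\<dots> = (\<Sum>i<n. integral {0..pi} (\<lambda>t. c i * (cos (real i * t) * cos (real k * t))))"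
        by (intro integral_sum integrable_continuous_real continuous_intros) simp
      also have "\<dots> = (\<Sum>i<n. if i = k then c k * (if k = 0 then pi else pi / 2) else 0)"
        by (intro sum.cong) (simp_all only: integral_mult_right integral_cos_mult_cos, auto)
      also have "\<dots> = c k * (if k = 0 then pi else pi / 2)" using n by (simp add: sum.delta)
      also have "\<dots> = pi / 2 * cheb_coeff f k" by (simp add: c_def)
      also have "\<dots> = integral {0..pi} (\<lambda>t. F t * cos (real k * t))"
        unfolding cheb_coeff_eq_cos[OF f] F_def by simp
      finally have "integral {0..pi} (\<lambda>t. (F t - s n t) * cos (real k * t)) = 0"
        unfolding left_diff_distrib
        by (subst integral_diff, (intro integrable_continuous_real continuous_intros cF cs)+) simp
      then show ?thesis using I integral_unique by metis
    qed
    have "eventually (\<lambda>n. I n = 0) sequentially"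
      by (rule eventually_mono[OF eventually_gt_at_top[of k]]) (rule I0)
    then have "I \<longlonglongrightarrow> 0" by (rule tendsto_eventually)
    then have "J = 0" using IJ LIMSEQ_unique by blast
    then show ?thesis using J by (simp add: integral_unique)
  qed
  have ax: "arccos x \<in> {0..pi}" using x by (simp add: arccos_lbound arccos_ubound)
  have "F (arccos x) - G (arccos x) = 0"
    by (rule cos_fourier_unique[OF _ zero ax]) (intro continuous_intros cF cG)
  then have "f x = G (arccos x)" using x by (simp add: F_def cos_arccos)
  moreover have "(\<lambda>n. s n (arccos x)) \<longlonglongrightarrow> G (arccos x)"
    using tendsto_uniform_limitI[OF u ax] .
  then have "(\<lambda>n. s (Suc n) (arccos x)) \<longlonglongrightarrow> G (arccos x)" by (rule LIMSEQ_Suc)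
  moreover have "s (Suc n) (arccos x) = cheb_proj f n x" for n
  proof -
    have "s (Suc n) (arccos x) = c 0 + (\<Sum>i<n. c (Suc i) * cos (real (Suc i) * arccos x))"
      unfolding s_def sum.lessThan_Suc_shift by simp
    also have "(\<Sum>i<n. c (Suc i) * cos (real (Suc i) * arccos x)) = (\<Sum>k=1..n. cheb_coeff f k * cheb_T k x)"
      by (rule sum.reindex_bij_witness[of _ "\<lambda>k. k - 1" Suc]) (auto simp: c_def cheb_T_def)
    finally show ?thesis by (simp add: cheb_proj_def c_def)
  qed
  ultimately show ?thesis by simp
qed

section \<open>The error of the Chebyshev projection\<close>

lemma bigo_Suc:
  assumes "e \<le> 0" "u \<in> O(\<lambda>n. real n powr e)"
  shows "(\<lambda>n. u (Suc n)) \<in> O(\<lambda>n. real n powr e)"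
proof -
  have "(\<lambda>n. u (Suc n)) \<in> O(\<lambda>n. real (Suc n) powr e)"
    by (rule landau_o.big.compose[OF assms(2) filterlim_Suc])
  also have "(\<lambda>n. real (Suc n) powr e) \<in> O(\<lambda>n. real n powr e)"
    using eventually_gt_at_top[of "0::nat"]
    by (intro bigoI[of _ 1], eventually_elim) (use assms(1) in \<open>auto intro!: powr_mono2'\<close>)
  finally show ?thesis .
qed

text \<open>With \<tau> = arccos x, the products cos(k\<theta>) cos(k\<tau>) and sin(k\<theta>)
  cos(k\<tau>) split into cosines and sines of 2kp and 2kq, where p and q are half the sum and half
  the difference of \<tau> and \<theta>. Only the cosine tails exceed the error term.\<close>

lemma cheb_error_asymp:
  assumes f: "continuous_on {-1..1} f" and x: "x \<in> {-1..1}" and s: "s > 1"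
    and coeff: "(\<lambda>k. cheb_coeff f k - (A * cos (real k * \<theta>) * real k powr (- s) + B * sin (real k * \<theta>) * real k powr (- s - 1)))
      \<in> O(\<lambda>k. real k powr (- s - 2))"
  shows "(\<lambda>n. f x - cheb_proj f n x - A / 2 * (cos_tail s ((arccos x + \<theta>) / 2) n + cos_tail s ((arccos x - \<theta>) / 2) n))
      \<in> O(\<lambda>n. real n powr (- s - 1))"
proof -
  define \<tau> where "\<tau> = arccos x"
  define p where "p = (\<tau> + \<theta>) / 2"
  define q where "q = (\<tau> - \<theta>) / 2"
  define main where "main = (\<lambda>k. A * cos (real k * \<theta>) * real k powr (- s) + B * sin (real k * \<theta>) * real k powr (- s - 1))"
  have cb: "(\<lambda>k. c * cos (real k * y) * real k powr e) \<in> O(\<lambda>k. real k powr e)"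
    "(\<lambda>k. c * sin (real k * y) * real k powr e) \<in> O(\<lambda>k. real k powr e)" for c y e
    by (rule bigoI[of _ "\<bar>c\<bar>"]; simp add: abs_mult mult_right_mono mult_left_le)+
  have m: "main \<in> O(\<lambda>k. real k powr (- s))"
    unfolding main_def
    by (intro sum_in_bigo(1) cb landau_o.big.trans[OF cb(2) powr_bigo_mono]) simp
  have coeff': "(\<lambda>k. cheb_coeff f k - main k) \<in> O(\<lambda>k. real k powr (- s - 2))"
    unfolding main_def by (rule coeff)
  have "(\<lambda>k. cheb_coeff f k - main k) \<in> O(\<lambda>k. real k powr (- s))"
    by (rule landau_o.big.trans[OF coeff' powr_bigo_mono]) simp
  from sum_in_bigo(1)[OF this m] have cf: "cheb_coeff f \<in> O(\<lambda>k. real k powr (- s))" by simp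
  have sm: "summable (\<lambda>k. \<bar>cheb_coeff f k\<bar>)"
  proof (rule summable_comparison_test_bigo)
    show "summable (\<lambda>k. norm (real k powr (- s)))" using s by (simp add: summable_real_powr_iff)
    show "(\<lambda>k. \<bar>cheb_coeff f k\<bar>) \<in> O(\<lambda>k. real k powr (- s))" using cf by simp
  qed
  define w where "w = (\<lambda>k::nat. if k = 0 then cheb_coeff f 0 / 2 else cheb_coeff f k * cos (real k * \<tau>))"
  have proj: "cheb_proj f n x = (\<Sum>k\<le>n. w k)" for n
  proof -
    have "(\<Sum>k\<le>n. w k) = w 0 + (\<Sum>k=1..n. w k)"
      by (simp add: atMost_atLeast0 sum.atLeast_Suc_atMost)
    also have "(\<Sum>k=1..n. w k) = (\<Sum>k=1..n. cheb_coeff f k * cheb_T k x)"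
      by (rule sum.cong) (auto simp: w_def cheb_T_def \<tau>_def)
    finally show ?thesis by (simp add: cheb_proj_def w_def)
  qed
  have "(\<lambda>n. \<Sum>k\<le>n. w k) \<longlonglongrightarrow> f x"
    using cheb_series_LIMSEQ[OF f sm x] by (simp add: proj)
  then have w: "w sums f x" by (simp add: sums_def_le)
  define cosp where "cosp = (\<lambda>y k. cos (2 * real k * y) * real k powr (- s))"
  define sinp where "sinp = (\<lambda>y k. sin (2 * real k * y) * real k powr (- (s + 1)))"
  have scos: "summable (cosp y)" for y unfolding cosp_def by (rule summable_trig_powr[OF s]) simp
  have ssin: "summable (sinp y)" for y unfolding sinp_def by (rule summable_trig_powr) (use s in auto)
  \<comment> \<open>At k = 0 all the power terms are 0, so \<epsilon> also absorbs the halved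
    constant term of the series.\<close>
  define \<epsilon> where "\<epsilon> = (\<lambda>k. w k - (A / 2 * cosp p k + A / 2 * cosp q k + B / 2 * sinp p k - B / 2 * sinp q k))"
  have main_eq: "A / 2 * cosp p k + A / 2 * cosp q k + B / 2 * sinp p k - B / 2 * sinp q k = main k * cos (real k * \<tau>)" for k
  proof -
    have a: "2 * real k * p = real k * \<tau> + real k * \<theta>" "2 * real k * q = real k * \<tau> - real k * \<theta>"
      by (simp_all add: p_def q_def field_simps)
    define P where "P = real k powr (- s)"
    define Q where "Q = real k powr (- s - 1)"
    have Q: "real k powr (- (s + 1)) = Q" by (simp add: Q_def)
    show ?thesis
      unfolding cosp_def sinp_def main_def a cos_add cos_diff sin_add sin_diff Q P_def[symmetric] Q_def[symmetric]
      by (simp add: algebra_simps)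
  qed
  have \<epsilon>b: "\<epsilon> \<in> O(\<lambda>k. real k powr (- s - 2))"
  proof -
    have "(\<lambda>k. cos (real k * \<tau>)) \<in> O(\<lambda>_. 1)" by (rule bigoI[of _ 1]) simp
    from landau_o.big.mult[OF coeff' this]
    have "(\<lambda>k. (cheb_coeff f k - main k) * cos (real k * \<tau>)) \<in> O(\<lambda>k. real k powr (- s - 2))" by simp
    moreover have ev: "eventually (\<lambda>k. (cheb_coeff f k - main k) * cos (real k * \<tau>) = \<epsilon> k) at_top"
      unfolding \<epsilon>_def main_eq w_def using eventually_gt_at_top[of 0]
      by eventually_elim (simp add: left_diff_distrib)
    ultimately show ?thesis unfolding landau_o.big.in_cong[OF ev] by simp
  qed
  have s\<epsilon>: "summable \<epsilon>"
    unfolding \<epsilon>_def using w scos ssin by (intro summable_diff summable_add summable_mult) (auto simp: sums_iff)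
  have e: "- (s + 1) - 1 = - s - 2" "- (s + 1) = - s - 1" by simp_all
  have t\<epsilon>: "(\<lambda>n. suminf \<epsilon> - (\<Sum>k\<le>n. \<epsilon> k)) \<in> O(\<lambda>n. real n powr (- s - 1))"
  proof -
    \<comment> \<open>No oscillation is used for the remainder: \<open>tail_sum_bigo\<close> with A
      = 0 loses one power of n, which is affordable.\<close>
    have "(\<lambda>n. 0 - 0 - \<epsilon> (Suc n)) \<in> O(\<lambda>n. real n powr (- (s + 1) - 1))"
      unfolding e(1) using bigo_Suc[OF _ \<epsilon>b] s by simp
    from tail_sum_bigo[OF s\<epsilon> tendsto_const _ this] s show ?thesis
      unfolding e(2) by simp
  qed
  have tc: "(\<lambda>n. c * (suminf (cosp y) - (\<Sum>k\<le>n. cosp y k) - cos_tail s y n)) \<in> O(\<lambda>n. real n powr (- s - 1))" for c y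
    unfolding cosp_def by (rule bigo_cmult[OF cos_tail_asymp[OF s]])
  have ts: "(\<lambda>n. c * (suminf (sinp y) - (\<Sum>k\<le>n. sinp y k))) \<in> O(\<lambda>n. real n powr (- s - 1))" for c y
    unfolding sinp_def using bigo_cmult[OF sin_tail_asymp[of "s + 1" y], of c] s unfolding e by simp
  have wk: "w k = A / 2 * cosp p k + A / 2 * cosp q k + B / 2 * sinp p k - B / 2 * sinp q k + \<epsilon> k" for k
    by (simp add: \<epsilon>_def)
  have fx: "f x = A / 2 * suminf (cosp p) + A / 2 * suminf (cosp q) + B / 2 * suminf (sinp p) - B / 2 * suminf (sinp q) + suminf \<epsilon>"
  proof (rule sums_unique2[OF w])
    show "w sums (A / 2 * suminf (cosp p) + A / 2 * suminf (cosp q) + B / 2 * suminf (sinp p) - B / 2 * suminf (sinp q) + suminf \<epsilon>)"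
      unfolding wk by (intro sums_add sums_diff sums_mult summable_sums scos ssin s\<epsilon>)
  qed
  have pr: "cheb_proj f n x = A / 2 * (\<Sum>k\<le>n. cosp p k) + A / 2 * (\<Sum>k\<le>n. cosp q k) + B / 2 * (\<Sum>k\<le>n. sinp p k)
     - B / 2 * (\<Sum>k\<le>n. sinp q k) + (\<Sum>k\<le>n. \<epsilon> k)" for n
    unfolding proj wk by (simp add: sum.distrib sum_subtractf sum_distrib_left)
  have eq: "f x - cheb_proj f n x - A / 2 * (cos_tail s p n + cos_tail s q n) =
     A / 2 * (suminf (cosp p) - (\<Sum>k\<le>n. cosp p k) - cos_tail s p n) + A / 2 * (suminf (cosp q) - (\<Sum>k\<le>n. cosp q k) - cos_tail s q n)
     + B / 2 * (suminf (sinp p) - (\<Sum>k\<le>n. sinp p k)) + (- B / 2) * (suminf (sinp q) - (\<Sum>k\<le>n. sinp q k)) + (suminf \<epsilon> - (\<Sum>k\<le>n. \<epsilon> k))" for n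
    unfolding fx pr by (simp add: algebra_simps)
  show ?thesis
    unfolding \<tau>_def[symmetric] p_def[symmetric] q_def[symmetric] eq
    by (intro sum_in_bigo(1) tc ts t\<epsilon>)
qed

section \<open>Chebyshev coefficients of the model function\<close>

lemma continuous_on_smooth_real_on:
  assumes "smooth_real_on S g"
  shows "continuous_on S g"
proof -
  obtain D where D: "\<And>x. x \<in> S \<Longrightarrow> D 0 x = g x"
    "\<And>k x. x \<in> S \<Longrightarrow> (D k has_real_derivative D (Suc k) x) (at x within S)"
    using assms unfolding smooth_real_on_def by metis
  have "continuous_on S (D 0)" by (rule DERIV_continuous_on[OF D(2)])
  then show ?thesis using D(1) by (simp cong: continuous_on_cong)
qed

lemma continuous_on_model_fun:
  assumes "\<alpha> > 0" "smooth_real_on {-1..1} g"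
  shows "continuous_on {-1..1} (model_fun \<alpha> \<xi> g)"
  unfolding model_fun_def[abs_def]
  by (intro continuous_on_mult continuous_on_powr' continuous_intros continuous_on_smooth_real_on assms)
    (use assms in auto)

text \<open>(cos t - cos \<theta>)^2 = vers(t - \<theta>) vers(t + \<theta>) / 4. With s = t -
  \<theta>, the second factor is vers(s + 2\<theta>), which is positive between neighbouring
  singularities; its power joins g(cos t) to form W.\<close>

lemma cheb_coeff_interior:
  assumes \<xi>: "\<xi> \<in> {-1<..<1}" and \<alpha>: "\<alpha> > 0" and g: "smooth_real_on {-1..1} g"
  obtains B where
    "(\<lambda>k. cheb_coeff (model_fun \<alpha> \<xi> g) k - (I1 \<alpha> \<xi> g * cos (real k * arccos \<xi>) * real k powr (- (\<alpha> + 1))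
        + B * sin (real k * arccos \<xi>) * real k powr (- (\<alpha> + 1) - 1))) \<in> O(\<lambda>k. real k powr (- (\<alpha> + 1) - 2))"
proof -
  define \<theta> where "\<theta> = arccos \<xi>"
  have \<theta>: "0 < \<theta>" "\<theta> < pi" "cos \<theta> = \<xi>"
    using \<xi> arccos_lt_bounded[of \<xi>] by (auto simp: \<theta>_def cos_arccos)
  define S where "S = {- 2 * \<theta><..<2 * pi - 2 * \<theta>}"
  define F where "F = (\<lambda>t. model_fun \<alpha> \<xi> g (cos t))"
  define W where "W = (\<lambda>s. (1 / 4) powr (\<alpha> / 2) * (vers (1 * s + 2 * \<theta>) powr (\<alpha> / 2) * g (cos (1 * s + \<theta>))))"
  have cm: "continuous_on {-1..1} (model_fun \<alpha> \<xi> g)" by (rule continuous_on_model_fun[OF \<alpha> g])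
  have cF: "continuous_on UNIV F"
    unfolding F_def by (intro continuous_on_compose2[OF cm] continuous_intros) auto
  have oS: "open S" by (simp add: S_def)
  have vp: "vers (1 * s + 2 * \<theta>) > 0" if "s \<in> S" for s
    using that by (intro vers_pos) (auto simp: S_def abs_if)
  have W: "ck_on m S W" for m
  proof -
    have g': "ck_on m UNIV (\<lambda>s. g (cos (1 * s + \<theta>)))"
      using ck_on_affine[OF open_UNIV ck_on_smooth_cos[OF g], of m 1 \<theta>] by simp
    have v': "ck_on m UNIV (\<lambda>s. vers (1 * s + 2 * \<theta>))"
      using ck_on_affine[OF open_UNIV ck_on_vers, of m 1 "2 * \<theta>"] by simp
    show ?thesis
      unfolding W_def
      by (rule ck_on_cmult[OF oS ck_on_mult[OF oS ck_on_powr[OF oS vp ck_on_subset[OF v' subset_UNIV]] ck_on_subset[OF g' subset_UNIV]]])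
  qed
  have FW: "F (s + \<theta>) = vers s powr (\<alpha> / 2) * W s" for s
  proof -
    have "(cos (s + \<theta>) - cos \<theta>)\<^sup>2 = 1 / 4 * (vers s * vers (1 * s + 2 * \<theta>))"
    proof -
      have d: "cos (s + \<theta>) - cos \<theta> = 2 * sin ((s + 2 * \<theta>) / 2) * sin (- s / 2)"
        using cos_diff_cos[of "s + \<theta>" \<theta>] by (simp add: algebra_simps)
      show ?thesis unfolding d vers_half by (simp add: power_mult_distrib)
    qed
    then have "((cos (s + \<theta>) - cos \<theta>)\<^sup>2) powr (\<alpha> / 2) = (1 / 4) powr (\<alpha> / 2) * (vers s powr (\<alpha> / 2) * vers (1 * s + 2 * \<theta>) powr (\<alpha> / 2))"
      by (simp only: powr_mult)
    moreover have "(y\<^sup>2) powr (\<alpha> / 2) = \<bar>y\<bar> powr \<alpha>" for y :: real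
    proof -
      have "y\<^sup>2 = \<bar>y\<bar> powr 2" by simp
      then show ?thesis by (simp only: powr_powr) simp
    qed
    ultimately show ?thesis
      unfolding F_def model_fun_def W_def \<theta>(3) by (simp add: mult_ac)
  qed
  have b: "\<alpha> / 2 > 0" using \<alpha> by simp
  obtain B where B: "(\<lambda>k. integral {-pi..pi} (\<lambda>t. F t * cos (real k * t))
        - (2 * W 0 * vers_const (\<alpha> / 2) * cos (real k * \<theta>) * real k powr (- 2 * (\<alpha> / 2) - 1) + B * sin (real k * \<theta>) * real k powr (- 2 * (\<alpha> / 2) - 2)))
        \<in> O(\<lambda>k. real k powr (- 2 * (\<alpha> / 2) - 3))"
    by (rule fourier_two_singularities[OF b \<theta>(1,2) cF _ _ W[unfolded S_def] FW]) (auto simp: F_def)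
  \<comment> \<open>vers(2\<theta>) = 4 sin^2 \<theta> = 4(1 - \<xi>^2), the origin of the power of
    1 - \<xi>^2 in \<open>I1\<close>.\<close>
  have W0: "W 0 = (1 - \<xi>\<^sup>2) powr (\<alpha> / 2) * g \<xi>"
  proof -
    have "vers (2 * \<theta>) = 4 * (1 - \<xi>\<^sup>2)"
      unfolding vers_half using \<theta>(3) sin_squared_eq[of \<theta>] by (simp add: power_mult_distrib)
    then have "(1 / 4) powr (\<alpha> / 2) * vers (2 * \<theta>) powr (\<alpha> / 2) = (1 - \<xi>\<^sup>2) powr (\<alpha> / 2)"
      unfolding powr_mult[symmetric] by (simp add: diff_divide_distrib)
    then show ?thesis unfolding W_def by (simp add: mult.assoc[symmetric] \<theta>(3))
  qed
  have A: "1 / pi * (2 * W 0 * vers_const (\<alpha> / 2)) = I1 \<alpha> \<xi> g"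
    unfolding W0 vers_const_def I1_def by (simp add: mult_ac)
  have e: "- 2 * (\<alpha> / 2) - 1 = - (\<alpha> + 1)" "- 2 * (\<alpha> / 2) - 2 = - (\<alpha> + 1) - 1" "- 2 * (\<alpha> / 2) - 3 = - (\<alpha> + 1) - 2"
    by simp_all
  have "(\<lambda>k. cheb_coeff (model_fun \<alpha> \<xi> g) k - (I1 \<alpha> \<xi> g * cos (real k * arccos \<xi>) * real k powr (- (\<alpha> + 1))
        + B / pi * sin (real k * arccos \<xi>) * real k powr (- (\<alpha> + 1) - 1))) \<in> O(\<lambda>k. real k powr (- (\<alpha> + 1) - 2))"
    using bigo_cmult[OF B[unfolded e], of "1 / pi"]
    unfolding cheb_coeff_eq_fourier[OF cm] A[symmetric] \<theta>_def[symmetric] F_def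
    by (simp add: algebra_simps add_divide_distrib diff_divide_distrib)
  then show thesis by (rule that)
qed

text \<open>Here |cos t - \<xi>| is exactly vers(t - \<theta>) / 2, so b = \<alpha> and the decay
  exponent is 2\<alpha> + 1. Since sin(k\<theta>) = 0, the sine coefficients drop out, and B = 0.
  The factor (1/2)^\<alpha> accounts for the power of 2 in \<open>Bcoef\<close>.\<close>

lemma cheb_coeff_endpoint:
  assumes \<xi>: "\<xi> = 1 \<or> \<xi> = -1" and \<alpha>: "\<alpha> > 0" and g: "smooth_real_on {-1..1} g"
  shows
    "(\<lambda>k. cheb_coeff (model_fun \<alpha> \<xi> g) k - (Bcoef \<alpha> \<xi> g * cos (real k * arccos \<xi>) * real k powr (- (2 * \<alpha> + 1))
        + 0 * sin (real k * arccos \<xi>) * real k powr (- (2 * \<alpha> + 1) - 1))) \<in> O(\<lambda>k. real k powr (- (2 * \<alpha> + 1) - 2))"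
proof -
  define \<theta> where "\<theta> = arccos \<xi>"
  have \<theta>: "0 \<le> \<theta>" "\<theta> \<le> 2 * pi" "cos \<theta> = \<xi>" "sin \<theta> = 0"
    using \<xi> by (auto simp: \<theta>_def)
  define F where "F = (\<lambda>t. model_fun \<alpha> \<xi> g (cos t))"
  define W where "W = (\<lambda>s. (1 / 2) powr \<alpha> * g (cos (1 * s + \<theta>)))"
  have cm: "continuous_on {-1..1} (model_fun \<alpha> \<xi> g)" by (rule continuous_on_model_fun[OF \<alpha> g])
  have W: "ck_on m UNIV W" for m
    unfolding W_def using ck_on_affine[OF open_UNIV ck_on_smooth_cos[OF g], of m 1 \<theta>]
    by (intro ck_on_cmult) auto
  have per: "W (s + 2 * pi) = W s" for s
    using cos_periodic[of "s + \<theta>"] by (simp add: W_def algebra_simps)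
  have FW: "F (s + \<theta>) = vers s powr \<alpha> * W s" for s
  proof -
    have eq: "\<bar>cos (s + \<theta>) - \<xi>\<bar> = 1 / 2 * vers s"
      unfolding cos_add \<theta>(3,4) using \<xi> vers_nonneg[of s] by (auto simp: vers_def)
    show ?thesis
      unfolding F_def model_fun_def W_def eq powr_mult by (simp only: mult_1 mult_ac)
  qed
  obtain B where B: 
    "(\<lambda>k. integral {-pi..pi} (\<lambda>s. vers s powr \<alpha> * W s * cos (real k * s)) - W 0 * vers_const \<alpha> * real k powr (- 2 * \<alpha> - 1))
        \<in> O(\<lambda>k. real k powr (- 2 * \<alpha> - 3))"
    using fourier_vers_mult_asymp[OF \<alpha> W per] by metis
  have eq: "integral {-pi..pi} (\<lambda>t. F t * cos (real k * t)) = cos (real k * \<theta>) * integral {-pi..pi} (\<lambda>s. vers s powr \<alpha> * W s * cos (real k * s))" for k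
  proof -
    have "continuous_on UNIV (\<lambda>s. vers s powr \<alpha> * W s)"
      by (intro continuous_intros continuous_on_vers_powr \<alpha> ck_on_imp_continuous_on[OF W[of 0]])
    from fourier_cos_shift[OF this _ \<theta>(1,2), of k] show ?thesis
      unfolding FW[symmetric] sin_multiple_eq_0[OF \<theta>(4)] by (simp add: FW vers_periodic per)
  qed
  have A: "1 / pi * (W 0 * vers_const \<alpha>) = Bcoef \<alpha> \<xi> g"
  proof -
    have "(1 / 2) powr \<alpha> = 1 / (2 * 2 powr (\<alpha> - 1) :: real)" by (simp add: powr_diff powr_divide)
    then show ?thesis
      unfolding W_def vers_const_def Bcoef_def by (simp add: \<theta>(3) mult_ac)
  qed
  have e: "- 2 * \<alpha> - 1 = - (2 * \<alpha> + 1)" "- 2 * \<alpha> - 3 = - (2 * \<alpha> + 1) - 2"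
    by simp_all
  have bc: "(\<lambda>k. 1 / pi * cos (real k * \<theta>)) \<in> O(\<lambda>_. 1)"
    by (rule bigo_cmult, rule bigoI[of _ 1]) simp
  show ?thesis
    using landau_o.big.mult[OF bc B[unfolded e]]
    unfolding cheb_coeff_eq_fourier[OF cm] A[symmetric] \<theta>_def[symmetric] eq[unfolded F_def]
    by (simp add: algebra_simps add_divide_distrib diff_divide_distrib)
qed

lemma cos_tail_cheb_U:
  assumes "sin \<phi> \<noteq> 0"
  shows "cos_tail s \<phi> n = - (cheb_U (2 * n) (cos \<phi>) / 2) * real n powr (- s)"
proof -
  have "sin (real (2 * n + 1) * \<phi>) = cheb_U (2 * n) (cos \<phi>) * sin \<phi>"
    using cheb_U_cos[of "2 * n" \<phi>] by simp
  then show ?thesis using assms unfolding cos_tail_def by simp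
qed

text \<open>As 2n + 1 is odd, both sines in the quotient change sign. For \<xi> = -1 this identifies
  the tails at \<open>phi_plus\<close> and \<open>phi_minus\<close>, which differ by pi.\<close>

lemma cos_tail_minus_pi: "cos_tail s (\<phi> - pi) n = cos_tail s \<phi> n"
proof -
  define N where "N = 2 * n + 1"
  have "real N * (\<phi> - pi) = real N * \<phi> - real N * pi" by (rule right_diff_distrib)
  then have "sin (real N * (\<phi> - pi)) = - sin (real N * \<phi>)"
    using cos_npi[of N] sin_npi[of N] by (simp add: sin_diff N_def)
  then show ?thesis unfolding cos_tail_def N_def[symmetric] by simp
qed

lemma sin_neq_0_pos: "0 < \<phi> \<Longrightarrow> \<phi> < pi \<Longrightarrow> sin \<phi> \<noteq> 0"
  using sin_gt_zero[of \<phi>] by simp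

theorem theorem2p5:
  fixes \<alpha> \<xi> :: real and g :: "real \<Rightarrow> real"
  assumes "\<xi> \<in> {-1..1}"
    and "\<alpha> > 0"
    and "\<xi> \<in> {-1<..<1} \<Longrightarrow> \<not> (\<exists>m::int. even m \<and> \<alpha> = of_int m)"
    and "\<xi> = 1 \<or> \<xi> = -1 \<Longrightarrow> \<alpha> \<notin> \<int>"
    and "smooth_real_on {-1..1} g"
    and "g \<xi> \<noteq> 0"
  shows
    "(\<xi> \<in> {-1<..<1} \<longrightarrow>
        (\<forall>x\<in>{-1..1}. x \<noteq> \<xi> \<longrightarrow>
          (\<lambda>n. model_fun \<alpha> \<xi> g x - cheb_proj (model_fun \<alpha> \<xi> g) n x
               - (- (I1 \<alpha> \<xi> g / 4)
                  * (cheb_U (2 * n) (cos (phi_plus \<xi> x)) + cheb_U (2 * n) (cos (phi_minus \<xi> x)))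
                  * real n powr (- \<alpha> - 1)))
            \<in> O(\<lambda>n. real n powr (- \<alpha> - 2))) \<and>
        (\<lambda>n. model_fun \<alpha> \<xi> g \<xi> - cheb_proj (model_fun \<alpha> \<xi> g) n \<xi>
             - (I1 \<alpha> \<xi> g / (2 * \<alpha>) * real n powr (- \<alpha>)
                - I1 \<alpha> \<xi> g * ((cheb_U (2 * n) \<xi> + 1) / 4) * real n powr (- \<alpha> - 1)))
          \<in> O(\<lambda>n. real n powr (- \<alpha> - 2))) \<and>
     (\<xi> = 1 \<longrightarrow>
        (\<lambda>n. model_fun \<alpha> \<xi> g \<xi> - cheb_proj (model_fun \<alpha> \<xi> g) n \<xi>
             - Bcoef \<alpha> \<xi> g * (1 / (2 * \<alpha>) * real n powr (- 2 * \<alpha>)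
                               - 1 / 2 * real n powr (- 2 * \<alpha> - 1)))
          \<in> O(\<lambda>n. real n powr (- 2 * \<alpha> - 2)) \<and>
        (\<forall>x\<in>{-1..1}. x \<noteq> \<xi> \<longrightarrow>
          (\<lambda>n. model_fun \<alpha> \<xi> g x - cheb_proj (model_fun \<alpha> \<xi> g) n x
               - Bcoef \<alpha> \<xi> g * (- (cheb_U (2 * n) (cos (phi_plus \<xi> x)) / 2)
                                 * real n powr (- 2 * \<alpha> - 1)))
            \<in> O(\<lambda>n. real n powr (- 2 * \<alpha> - 2)))) \<and>
     (\<xi> = -1 \<longrightarrow>
        (\<lambda>n. model_fun \<alpha> \<xi> g \<xi> - cheb_proj (model_fun \<alpha> \<xi> g) n \<xi>
             - Bcoef \<alpha> \<xi> g * (1 / (2 * \<alpha>) * real n powr (- 2 * \<alpha>)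
                               - 1 / 2 * real n powr (- 2 * \<alpha> - 1)))
          \<in> O(\<lambda>n. real n powr (- 2 * \<alpha> - 2)) \<and>
        (\<forall>x\<in>{-1..1}. x \<noteq> \<xi> \<longrightarrow>
          (\<lambda>n. model_fun \<alpha> \<xi> g x - cheb_proj (model_fun \<alpha> \<xi> g) n x
               - Bcoef \<alpha> \<xi> g * (- (cheb_U (2 * n) (cos (phi_minus \<xi> x)) / 2)
                                 * real n powr (- 2 * \<alpha> - 1)))
            \<in> O(\<lambda>n. real n powr (- 2 * \<alpha> - 2))))"
proof (intro conjI impI)
  note \<alpha> = \<open>\<alpha> > 0\<close> and g = \<open>smooth_real_on {-1..1} g\<close>
  have cm: "continuous_on {-1..1} (model_fun \<alpha> \<xi> g)" by (rule continuous_on_model_fun[OF \<alpha> g])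
  {
    assume \<xi>: "\<xi> \<in> {-1<..<1}"
    have s: "\<alpha> + 1 > 1" using \<alpha> by simp
    obtain B where B: "(\<lambda>k. cheb_coeff (model_fun \<alpha> \<xi> g) k - (I1 \<alpha> \<xi> g * cos (real k * arccos \<xi>) * real k powr (- (\<alpha> + 1))
        + B * sin (real k * arccos \<xi>) * real k powr (- (\<alpha> + 1) - 1))) \<in> O(\<lambda>k. real k powr (- (\<alpha> + 1) - 2))"
      by (rule cheb_coeff_interior[OF \<xi> \<alpha> g])
    have e: "- (\<alpha> + 1) - 1 = - \<alpha> - 2" "- (\<alpha> + 1) = - \<alpha> - 1" "1 - (\<alpha> + 1) = - \<alpha>" "\<alpha> + 1 - 1 = \<alpha>" by simp_all
    note err = cheb_error_asymp[OF cm _ s B, unfolded e(1), folded phi_plus_def phi_minus_def]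
    have \<theta>: "0 < arccos \<xi>" "arccos \<xi> < pi" using \<xi> arccos_lt_bounded[of \<xi>] by auto
    show "\<forall>x\<in>{-1..1}. x \<noteq> \<xi> \<longrightarrow>
          (\<lambda>n. model_fun \<alpha> \<xi> g x - cheb_proj (model_fun \<alpha> \<xi> g) n x
               - (- (I1 \<alpha> \<xi> g / 4)
                  * (cheb_U (2 * n) (cos (phi_plus \<xi> x)) + cheb_U (2 * n) (cos (phi_minus \<xi> x)))
                  * real n powr (- \<alpha> - 1)))
            \<in> O(\<lambda>n. real n powr (- \<alpha> - 2))"
    proof (intro ballI impI)
      fix x assume x: "x \<in> {-1..1}" "x \<noteq> \<xi>"
      have ax: "0 \<le> arccos x" "arccos x \<le> pi" using x by (auto simp: arccos_lbound arccos_ubound)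
      have ne: "arccos x \<noteq> arccos \<xi>"
      proof
        assume "arccos x = arccos \<xi>"
        then have "cos (arccos x) = cos (arccos \<xi>)" by simp
        then show False using x \<xi> by simp
      qed
      \<comment> \<open>For x \<noteq> \<xi> neither angle is a multiple of pi, so both tails
        oscillate and no term of order n^(-\<alpha>) arises.\<close>
      have p: "sin (phi_plus \<xi> x) \<noteq> 0"
        by (rule sin_neq_0_pos) (use ax \<theta> in \<open>auto simp: phi_plus_def\<close>)
      have q: "sin (phi_minus \<xi> x) \<noteq> 0"
      proof (cases "arccos x > arccos \<xi>")
        case True
        then show ?thesis by (intro sin_neq_0_pos) (use ax \<theta> in \<open>auto simp: phi_minus_def\<close>)
      next
        case False
        with ne have "arccos x < arccos \<xi>" by simp
        then have "0 < - phi_minus \<xi> x" "- phi_minus \<xi> x < pi"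
          unfolding phi_minus_def using ax \<theta> by (simp_all add: field_simps)
        then have "sin (- phi_minus \<xi> x) \<noteq> 0" by (rule sin_neq_0_pos)
        then show ?thesis by simp
      qed
      have eq: "I1 \<alpha> \<xi> g / 2 * (cos_tail (\<alpha> + 1) (phi_plus \<xi> x) n + cos_tail (\<alpha> + 1) (phi_minus \<xi> x) n) =
         - (I1 \<alpha> \<xi> g / 4) * (cheb_U (2 * n) (cos (phi_plus \<xi> x)) + cheb_U (2 * n) (cos (phi_minus \<xi> x))) * real n powr (- \<alpha> - 1)" for n
        unfolding cos_tail_cheb_U[OF p] cos_tail_cheb_U[OF q] e(2) by (simp add: algebra_simps)
      show "(\<lambda>n. model_fun \<alpha> \<xi> g x - cheb_proj (model_fun \<alpha> \<xi> g) n x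
               - (- (I1 \<alpha> \<xi> g / 4)
                  * (cheb_U (2 * n) (cos (phi_plus \<xi> x)) + cheb_U (2 * n) (cos (phi_minus \<xi> x)))
                  * real n powr (- \<alpha> - 1)))
            \<in> O(\<lambda>n. real n powr (- \<alpha> - 2))"
        using err[OF x(1)] unfolding eq .
    qed
    \<comment> \<open>At x = \<xi> the angle \<open>phi_minus\<close> is 0 and gives the two
      non-oscillating terms, while \<open>phi_plus\<close> = arccos \<xi> still oscillates and gives
      U_2n(\<xi>).\<close>
    have p: "phi_plus \<xi> \<xi> = arccos \<xi>" "phi_minus \<xi> \<xi> = 0" by (simp_all add: phi_plus_def phi_minus_def)
    have eq: "I1 \<alpha> \<xi> g / 2 * (cos_tail (\<alpha> + 1) (phi_plus \<xi> \<xi>) n + cos_tail (\<alpha> + 1) (phi_minus \<xi> \<xi>) n) =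
        I1 \<alpha> \<xi> g / (2 * \<alpha>) * real n powr (- \<alpha>) - I1 \<alpha> \<xi> g * ((cheb_U (2 * n) \<xi> + 1) / 4) * real n powr (- \<alpha> - 1)" for n
    proof -
      have t0: "cos_tail (\<alpha> + 1) 0 n = real n powr (- \<alpha>) / \<alpha> - real n powr (- \<alpha> - 1) / 2"
        by (simp add: cos_tail_def e(2))
      have t1: "cos_tail (\<alpha> + 1) (arccos \<xi>) n = - (cheb_U (2 * n) \<xi> / 2) * real n powr (- \<alpha> - 1)"
        using cos_tail_cheb_U[OF sin_neq_0_pos[OF \<theta>], of "\<alpha> + 1" n] \<xi> unfolding e(2) by (simp add: cos_arccos)
      show ?thesis unfolding p t0 t1 using \<alpha> by (simp add: field_simps)
    qed
    have "\<xi> \<in> {-1..1}" using \<xi> by simp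
    from err[OF this]
    show "(\<lambda>n. model_fun \<alpha> \<xi> g \<xi> - cheb_proj (model_fun \<alpha> \<xi> g) n \<xi>
             - (I1 \<alpha> \<xi> g / (2 * \<alpha>) * real n powr (- \<alpha>)
                - I1 \<alpha> \<xi> g * ((cheb_U (2 * n) \<xi> + 1) / 4) * real n powr (- \<alpha> - 1)))
          \<in> O(\<lambda>n. real n powr (- \<alpha> - 2))"
      unfolding eq .
  }
  \<comment> \<open>Both halves of the error have the same tail, so \<open>Bcoef\<close> / 2 is
    counted twice and a single \<open>cos_tail\<close> remains.\<close>
  have end_err: "(\<lambda>n. model_fun \<alpha> \<xi> g x - cheb_proj (model_fun \<alpha> \<xi> g) n x - Bcoef \<alpha> \<xi> g * cos_tail (2 * \<alpha> + 1) \<phi> n)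
      \<in> O(\<lambda>n. real n powr (- 2 * \<alpha> - 2))"
    if \<xi>: "\<xi> = 1 \<and> \<phi> = phi_plus \<xi> x \<or> \<xi> = -1 \<and> \<phi> = phi_minus \<xi> x" and x: "x \<in> {-1..1}" for x \<phi>
  proof -
    have s: "2 * \<alpha> + 1 > 1" using \<alpha> by simp
    have e: "- (2 * \<alpha> + 1) - 1 = - 2 * \<alpha> - 2" by simp
    have \<xi>': "\<xi> = 1 \<or> \<xi> = -1" using \<xi> by blast
    note err = cheb_error_asymp[OF cm x s cheb_coeff_endpoint[OF \<xi>' \<alpha> g], unfolded e]
    have "cos_tail (2 * \<alpha> + 1) ((arccos x + arccos \<xi>) / 2) n = cos_tail (2 * \<alpha> + 1) \<phi> n \<and>
          cos_tail (2 * \<alpha> + 1) ((arccos x - arccos \<xi>) / 2) n = cos_tail (2 * \<alpha> + 1) \<phi> n" for n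
    proof (cases "\<xi> = 1")
      case True
      with \<xi> have \<phi>: "\<phi> = phi_plus \<xi> x" by simp
      show ?thesis unfolding \<phi> phi_plus_def True by simp
    next
      case False
      then have \<xi>1: "\<xi> = -1" and \<phi>: "\<phi> = phi_minus \<xi> x" using \<xi> by auto
      have m: "(arccos x - pi) / 2 = (arccos x + pi) / 2 - pi" by (simp add: field_simps)
      show ?thesis unfolding \<phi> phi_minus_def \<xi>1 arccos_minus_1 m cos_tail_minus_pi by simp
    qed
    then show ?thesis using err by (simp add: mult.assoc)
  qed
  have tail_0: "cos_tail (2 * \<alpha> + 1) 0 n = 1 / (2 * \<alpha>) * real n powr (- 2 * \<alpha>) - 1 / 2 * real n powr (- 2 * \<alpha> - 1)" for n
    by (simp add: cos_tail_def)
  have tail_U: "cos_tail (2 * \<alpha> + 1) \<phi> n = - (cheb_U (2 * n) (cos \<phi>) / 2) * real n powr (- 2 * \<alpha> - 1)"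
    if "sin \<phi> \<noteq> 0" for \<phi> n
    using cos_tail_cheb_U[OF that, of "2 * \<alpha> + 1" n] by simp
  have arccos_pos: "0 < arccos x" if "x \<in> {-1..1}" "x \<noteq> 1" for x
    using that arccos_lbound[of x] cos_arccos[of x] by (cases "arccos x = 0") auto
  have arccos_less_pi: "arccos x < pi" if "x \<in> {-1..1}" "x \<noteq> -1" for x
    using that arccos_ubound[of x] cos_arccos[of x] by (cases "arccos x = pi") auto
  {
    assume \<xi>: "\<xi> = 1"
    show "(\<lambda>n. model_fun \<alpha> \<xi> g \<xi> - cheb_proj (model_fun \<alpha> \<xi> g) n \<xi>
             - Bcoef \<alpha> \<xi> g * (1 / (2 * \<alpha>) * real n powr (- 2 * \<alpha>)
                               - 1 / 2 * real n powr (- 2 * \<alpha> - 1)))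
          \<in> O(\<lambda>n. real n powr (- 2 * \<alpha> - 2))"
      using end_err[of 0 \<xi>] \<xi> unfolding tail_0 by (simp add: phi_plus_def)
    show "\<forall>x\<in>{-1..1}. x \<noteq> \<xi> \<longrightarrow>
          (\<lambda>n. model_fun \<alpha> \<xi> g x - cheb_proj (model_fun \<alpha> \<xi> g) n x
               - Bcoef \<alpha> \<xi> g * (- (cheb_U (2 * n) (cos (phi_plus \<xi> x)) / 2)
                                 * real n powr (- 2 * \<alpha> - 1)))
            \<in> O(\<lambda>n. real n powr (- 2 * \<alpha> - 2))"
    proof (intro ballI impI)
      fix x assume x: "x \<in> {-1..1}" "x \<noteq> \<xi>"
      have "sin (phi_plus \<xi> x) \<noteq> 0"
        using arccos_pos[of x] arccos_ubound[of x] x \<xi> pi_gt_zero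
        by (intro sin_neq_0_pos) (auto simp: phi_plus_def)
      from end_err[of "phi_plus \<xi> x" x, unfolded tail_U[OF this]] x \<xi>
      show "(\<lambda>n. model_fun \<alpha> \<xi> g x - cheb_proj (model_fun \<alpha> \<xi> g) n x
               - Bcoef \<alpha> \<xi> g * (- (cheb_U (2 * n) (cos (phi_plus \<xi> x)) / 2)
                                 * real n powr (- 2 * \<alpha> - 1)))
            \<in> O(\<lambda>n. real n powr (- 2 * \<alpha> - 2))" by blast
    qed
  }
  {
    assume \<xi>: "\<xi> = -1"
    show "(\<lambda>n. model_fun \<alpha> \<xi> g \<xi> - cheb_proj (model_fun \<alpha> \<xi> g) n \<xi>
             - Bcoef \<alpha> \<xi> g * (1 / (2 * \<alpha>) * real n powr (- 2 * \<alpha>)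
                               - 1 / 2 * real n powr (- 2 * \<alpha> - 1)))
          \<in> O(\<lambda>n. real n powr (- 2 * \<alpha> - 2))"
      using end_err[of 0 \<xi>] \<xi> unfolding tail_0 by (simp add: phi_minus_def)
    show "\<forall>x\<in>{-1..1}. x \<noteq> \<xi> \<longrightarrow>
          (\<lambda>n. model_fun \<alpha> \<xi> g x - cheb_proj (model_fun \<alpha> \<xi> g) n x
               - Bcoef \<alpha> \<xi> g * (- (cheb_U (2 * n) (cos (phi_minus \<xi> x)) / 2)
                                 * real n powr (- 2 * \<alpha> - 1)))
            \<in> O(\<lambda>n. real n powr (- 2 * \<alpha> - 2))"
    proof (intro ballI impI)
      fix x assume x: "x \<in> {-1..1}" "x \<noteq> \<xi>"
      have ax: "arccos x < pi" "0 \<le> arccos x"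
        using arccos_less_pi[of x] arccos_lbound[of x] x \<xi> by auto
      \<comment> \<open>For x \<noteq> -1 the angle \<open>phi_minus\<close> lies in [-pi/2, 0), so
        its negative is the one to which \<open>sin_neq_0_pos\<close> applies.\<close>
      have m: "- phi_minus \<xi> x = pi / 2 - arccos x / 2"
        by (simp add: phi_minus_def \<xi> diff_divide_distrib)
      have "0 < - phi_minus \<xi> x" unfolding m using ax by linarith
      moreover have "- phi_minus \<xi> x < pi" unfolding m using ax pi_gt_zero by linarith
      ultimately have "sin (- phi_minus \<xi> x) \<noteq> 0" by (rule sin_neq_0_pos)
      then have "sin (phi_minus \<xi> x) \<noteq> 0" by simp
      from end_err[of "phi_minus \<xi> x" x, unfolded tail_U[OF this]] x \<xi>
      show "(\<lambda>n. model_fun \<alpha> \<xi> g x - cheb_proj (model_fun \<alpha> \<xi> g) n x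
               - Bcoef \<alpha> \<xi> g * (- (cheb_U (2 * n) (cos (phi_minus \<xi> x)) / 2)
                                 * real n powr (- 2 * \<alpha> - 1)))
            \<in> O(\<lambda>n. real n powr (- 2 * \<alpha> - 2))" by blast
    qed
  }
qed

end
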